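(* Let $n\ge1$ and $\beta<n+4$. Let $b\in H^{\sigma}(\mathbf{T}^n)$ with $\sigma\in\mathbb{R}$. For $\delta>0$ and $t\ge0$ let $U^{\delta,\beta}(t)$ be the solution of the nonlocal wave equation $\frac{d^2}{dt^2}U=L^{\delta,\beta}U+b$, $U(0)=0$, $\frac{d}{dt}U(0)=0$, given by $$U^{\delta,\beta}(t)=\hat b_0\frac{t^2}{2}+\sum_{0\ne k\in\mathbb{Z}^n}\frac{\hat b_k}{m_k}\left[\cos(\sqrt{-m_k}\,t)-1\right]e^{ik\cdot x}\in H^s(\mathbf{T}^n),$$ and let $U^0(t)$ be the solution of the local wave equation $\frac{d^2}{dt^2}U^0=\Delta U^0+b$, $U^0(0)=0$, $\frac{d}{dt}U^0(0)=0$, given by $$U^0(t)=\hat b_0\frac{t^2}{2}+\sum_{0\ne k\in\mathbb{Z}^n}\frac{\hat b_k}{-\|k\|^2}\left[\cos(\|k\|t)-1\right]e^{ik\cdot x}\in H^{s'}(\mathbf{T}^n),$$ where $s'=\sigma+2$ and $s=\sigma+\max\{0,\beta-n\}$. Let $t\ge0$. Then, when $\beta\le n+2$, $$\lim_{\delta\to0^+}U^{\delta,\beta}(t)=U^0(t)\quad\text{in }H^{s}(\mathbf{T}^n),$$ and when $n+2<\beta<n+4$, $$\lim_{\delta\to0^+}U^{\delta,\beta}(t)=U^0(t)\quad\text{in }H^{s'}(\mathbf{T}^n).$$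
   Context: For $k\in\mathbb{Z}^n$, $m_k=m^{\delta,\beta}(k)$, where for $\nu\in\mathbb{R}^n$ $$m^{\delta,\beta}(\nu)=-\|\nu\|^2\,{}_2F_3\!\left(1,\tfrac{n+2-\beta}{2};2,\tfrac{n+2}{2},\tfrac{n+4-\beta}{2};-\tfrac14\|\nu\|^2\delta^2\right),$$ ${}_2F_3(a_1,a_2;b_1,b_2,b_3;z)=\sum_{j\ge0}\frac{(a_1)_j(a_2)_j}{(b_1)_j(b_2)_j(b_3)_j}\frac{z^j}{j!}$, $(a)_j=a(a+1)\cdots(a+j-1)$. For $\beta<n+4$ one has $m_k<0$ for all $k\neq0$. The nonlocal Laplacian acts on periodic distributions by $L^{\delta,\beta}\big(\sum_k\hat T_ke^{ik\cdot x}\big)=\sum_km_k\hat T_ke^{ik\cdot x}$. $\mathbf{T}^n=\prod_{j=1}^n[0,2\pi]$ is the periodic torus; a periodic distribution $g$ is written $g=\sum_{k\in\mathbb{Z}^n}\hat g_ke^{ik\cdot x}$ with Fourier coefficients $\hat g_k$; for $q\in\mathbb{R}$, $H^q(\mathbf{T}^n)$ is the space of periodic distributions with $\|g\|_{H^q(\mathbf{T}^n)}^2=\sum_{k\in\mathbb{Z}^n}(1+\|k\|^2)^q|\hat g_k|^2<\infty$. *)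

theory Defs
  imports "HOL-Analysis.Analysis"
begin

definition hyp2F3 :: "real \<Rightarrow> real \<Rightarrow> real \<Rightarrow> real \<Rightarrow> real \<Rightarrow> real \<Rightarrow> real" where
  "hyp2F3 a1 a2 b1 b2 b3 z =
     (\<Sum>j. (pochhammer a1 j * pochhammer a2 j) /
            (pochhammer b1 j * pochhammer b2 j * pochhammer b3 j) * (z ^ j / fact j))"

definition multiplier :: "real \<Rightarrow> real \<Rightarrow> real ^ 'n \<Rightarrow> real" where
  "multiplier \<delta> \<beta> \<nu> =
     - (norm \<nu>)\<^sup>2 *
       hyp2F3 1 ((real CARD('n) + 2 - \<beta>) / 2)
              2 ((real CARD('n) + 2) / 2) ((real CARD('n) + 4 - \<beta>) / 2)
              (- (1 / 4) * (norm \<nu>)\<^sup>2 * \<delta>\<^sup>2)"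

definition freq :: "int ^ 'n \<Rightarrow> real ^ 'n" where
  "freq k = (\<chi> i. real_of_int (k $ i))"

definition fmode :: "int ^ 'n \<Rightarrow> real ^ 'n \<Rightarrow> complex" where
  "fmode k x = cis (freq k \<bullet> x)"


definition pd :: "'n \<Rightarrow> (real ^ 'n \<Rightarrow> complex) \<Rightarrow> real ^ 'n \<Rightarrow> complex" where
  "pd i \<phi> x = frechet_derivative \<phi> (at x) (axis i 1)"

text \<open>
  Test functions are the smooth functions that are \<open>2 * pi\<close>-periodic in each coordinate.
  Smooth means that every iterated partial derivative, the list giving the order of
  differentiation, is (Frechet) differentiable everywhere, hence also continuous.
\<close>

definition test_function :: "(real ^ 'n \<Rightarrow> complex) \<Rightarrow> bool" where
  "test_function \<phi> \<longleftrightarrow>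
     (\<forall>is x. fold pd is \<phi> differentiable (at x)) \<and>
     (\<forall>i x. \<phi> (x + axis i (2 * pi)) = \<phi> x)"

type_synonym 'n functional = "(real ^ 'n \<Rightarrow> complex) \<Rightarrow> complex"

text \<open>
  A periodic distribution is a linear functional on the test functions that is continuous with
  respect to the seminorms given by the suprema of the partial derivatives. Its values on
  functions that are not test functions carry no meaning, so two distributions \<open>S\<close> and \<open>T\<close> are
  to be identified when \<open>dist_eq S T\<close> holds.
\<close>

definition periodic_distribution :: "'n::finite functional \<Rightarrow> bool" where
  "periodic_distribution T \<longleftrightarrow>
     (\<forall>a \<phi> \<psi>. test_function \<phi> \<longrightarrow> test_function \<psi> \<longrightarrow>
        T (\<lambda>x. a * \<phi> x + \<psi> x) = a * T \<phi> + T \<psi>) \<and>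
     (\<exists>C N. \<forall>\<phi>. test_function \<phi> \<longrightarrow>
        cmod (T \<phi>) \<le> C * (\<Sum>is | length is \<le> N. SUP x. cmod (fold pd is \<phi> x)))"

definition dist_eq :: "'n::finite functional \<Rightarrow> 'n functional \<Rightarrow> bool" where
  "dist_eq S T \<longleftrightarrow> (\<forall>\<phi>. test_function \<phi> \<longrightarrow> S \<phi> = T \<phi>)"

text \<open>
  A periodic function \<open>g\<close> acts on a test function by integration over the torus, without
  normalisation. Thus the coefficient of \<open>fmode k\<close> in a distribution carries the factor
  \<open>(2 * pi) ^ -n\<close>, and the sum of a Fourier series is taken in the sense of distributions.
\<close>

definition torus :: "(real ^ 'n) set" where
  "torus = cbox 0 (\<chi> i. 2 * pi)"

definition fourier_coeff :: "'n::finite functional \<Rightarrow> int ^ 'n \<Rightarrow> complex" where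
  "fourier_coeff T k = T (fmode (- k)) / of_real ((2 * pi) ^ CARD('n))"

definition fourier_series :: "(int ^ 'n \<Rightarrow> complex) \<Rightarrow> 'n::finite functional" where
  "fourier_series c \<phi> = (\<Sum>\<^sub>\<infinity>k. c k * integral torus (\<lambda>x. fmode k x * \<phi> x))"


definition sobolev_space :: "real \<Rightarrow> 'n::finite functional set" where
  "sobolev_space q =
     {g. periodic_distribution g \<and>
         (\<lambda>k. (1 + (norm (freq k))\<^sup>2) powr q * (cmod (fourier_coeff g k))\<^sup>2) summable_on UNIV}"

definition sobolev_norm :: "real \<Rightarrow> 'n::finite functional \<Rightarrow> real" where
  "sobolev_norm q g =
     sqrt (\<Sum>\<^sub>\<infinity>k. (1 + (norm (freq k))\<^sup>2) powr q * (cmod (fourier_coeff g k))\<^sup>2)"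

text \<open>
  The membership clauses are essential: \<^const>\<open>infsum\<close> of a divergent series is \<open>0\<close>.
\<close>

definition sobolev_tendsto ::
  "real \<Rightarrow> ('a \<Rightarrow> 'n::finite functional) \<Rightarrow> 'n functional \<Rightarrow> 'a filter \<Rightarrow> bool" where
  "sobolev_tendsto q f g F \<longleftrightarrow>
     g \<in> sobolev_space q \<and> (\<forall>\<^sub>F a in F. f a \<in> sobolev_space q) \<and>
     ((\<lambda>a. sobolev_norm q (\<lambda>\<phi>. f a \<phi> - g \<phi>)) \<longlongrightarrow> 0) F"


definition nonlocal_laplacian :: "real \<Rightarrow> real \<Rightarrow> 'n::finite functional \<Rightarrow> 'n functional" where
  "nonlocal_laplacian \<delta> \<beta> T =
     fourier_series (\<lambda>k. of_real (multiplier \<delta> \<beta> (freq k)) * fourier_coeff T k)"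

definition laplacian :: "'n::finite functional \<Rightarrow> 'n functional" where
  "laplacian T \<phi> = T (\<lambda>x. \<Sum>i\<in>UNIV. pd i (pd i \<phi>) x)"

text \<open>
  \<open>U'' = A U + b\<close> for \<open>t \<ge> 0\<close> with \<open>U 0 = U' 0 = 0\<close>, where \<open>V\<close> is \<open>U'\<close>. Time derivatives of
  distribution-valued functions are weak: they are taken after applying the distribution to an
  arbitrary test function (one-sided at \<open>t = 0\<close>).
\<close>

definition wave_solution ::
  "('n::finite functional \<Rightarrow> 'n functional) \<Rightarrow> 'n functional \<Rightarrow> (real \<Rightarrow> 'n functional) \<Rightarrow> bool" where
  "wave_solution A b U \<longleftrightarrow>
     (\<exists>V. (\<forall>t\<ge>0. periodic_distribution (U t) \<and> periodic_distribution (V t)) \<and>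
        (\<forall>\<phi>. test_function \<phi> \<longrightarrow>
           U 0 \<phi> = 0 \<and> V 0 \<phi> = 0 \<and>
           (\<forall>t\<ge>0.
              ((\<lambda>\<tau>. U \<tau> \<phi>) has_vector_derivative V t \<phi>) (at t within {0..}) \<and>
              ((\<lambda>\<tau>. V \<tau> \<phi>) has_vector_derivative (A (U t) \<phi> + b \<phi>)) (at t within {0..}))))"

definition nonlocal_wave :: "real \<Rightarrow> real \<Rightarrow> 'n::finite functional \<Rightarrow> real \<Rightarrow> 'n functional" where
  "nonlocal_wave \<delta> \<beta> b t = fourier_series (\<lambda>k.
     if k = 0 then fourier_coeff b 0 * of_real (t\<^sup>2 / 2)
     else fourier_coeff b k / of_real (multiplier \<delta> \<beta> (freq k)) *
          of_real (cos (sqrt (- multiplier \<delta> \<beta> (freq k)) * t) - 1))"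

definition local_wave :: "'n::finite functional \<Rightarrow> real \<Rightarrow> 'n functional" where
  "local_wave b t = fourier_series (\<lambda>k.
     if k = 0 then fourier_coeff b 0 * of_real (t\<^sup>2 / 2)
     else fourier_coeff b k / of_real (- (norm (freq k))\<^sup>2) *
          of_real (cos (norm (freq k) * t) - 1))"

end

theory Submission
  imports Defs
begin

text \<open>
  On the Fourier side the solutions differ from \<open>b\<close> by the factors
  \<open>(cos (sqrt (- m) * t) - 1) / m\<close>, which are at most \<open>2 / \<bar>m\<bar>\<close>. Since
  \<open>m\<close> tends to \<open>- \<bar>k\<bar>\<^sup>2\<close> as \<open>\<delta>\<close> tends to \<open>0\<close>, the claim follows by dominated
  convergence once \<open>- m\<close> is bounded below, uniformly in small \<open>\<delta>\<close>, by a multiple of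
  \<open>\<bar>k\<bar>\<close> to the power \<open>min 2 (max 0 (\<beta> - n))\<close>.

  Put \<open>a = (n + 2 - \<beta>) / 2\<close>, \<open>\<nu> = n / 2\<close>, \<open>y = \<bar>k\<bar>\<^sup>2 * \<delta>\<^sup>2 / 4\<close>, \<open>F y = 2F3 (- y)\<close> and
  \<open>G y = 0F1 (\<nu>; - y)\<close>. The bound needed is \<open>F y \<ge> c * (1 + y) powr max (-1) (- a)\<close>. It comes
  from the first order equation \<open>y * (y * F' + a * F) = a * \<nu> * (1 - G)\<close> together with the Bessel
  equation \<open>y * G'' + \<nu> * G' + G = 0\<close>, whose energy \<open>G\<^sup>2 + y * G'\<^sup>2\<close> decreases from \<open>1\<close>
  because \<open>\<nu> \<ge> 1 / 2\<close>. So \<open>\<bar>G\<bar> \<le> 1\<close> and \<open>\<nu> * (1 - G) \<le> y\<close>, and \<open>y powr a * F\<close> is increasing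
  for \<open>a > 0\<close>, whereas \<open>y powr a * (F - 1)\<close> is increasing for \<open>a < 0\<close>.
\<close>

section \<open>Hypergeometric series at a negative argument\<close>

text \<open>The sign of the argument sits in the coefficients. For \<open>y = x^2 / 4\<close> with
  \<open>x > 0\<close>, the series is \<open>Gamma \<nu> * (x / 2) powr (1 - \<nu>)\<close> times
  the Bessel function of the first kind of order \<open>\<nu> - 1\<close>.\<close>

definition hyp0F1_neg_coeff :: "real \<Rightarrow> nat \<Rightarrow> real" where
  "hyp0F1_neg_coeff \<nu> j = (-1) ^ j / (fact j * pochhammer \<nu> j)"

definition hyp0F1_neg :: "real \<Rightarrow> real \<Rightarrow> real" where
  "hyp0F1_neg \<nu> y = (\<Sum>j. hyp0F1_neg_coeff \<nu> j * y ^ j)"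

lemma pochhammer_ge_min:
  fixes \<nu> :: real
  assumes "\<nu> > 0"
  shows "pochhammer \<nu> j \<ge> min 1 \<nu>"
proof (cases j)
  case (Suc i)
  have "pochhammer (\<nu> + 1) i \<ge> 1" for i
  proof (induction i)
    case (Suc i)
    have "1 * 1 \<le> pochhammer (\<nu> + 1) i * (\<nu> + 1 + real i)"
      using Suc assms by (intro mult_mono) auto
    then show ?case by (simp add: pochhammer_Suc)
  qed simp
  then have "\<nu> * 1 \<le> \<nu> * pochhammer (\<nu> + 1) i"
    using assms by (intro mult_left_mono) auto
  then show ?thesis by (simp add: Suc pochhammer_rec)
qed simp

text \<open>Comparison with the exponential series. Coefficient bounds of this form make both series
  below entire, so termwise differentiation is available at every point.\<close>

lemma summable_of_fact_bound:
  fixes c :: "nat \<Rightarrow> real"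
  assumes "\<And>j. \<bar>c j\<bar> \<le> K / fact j"
  shows "summable (\<lambda>j. c j * y ^ j)"
proof (rule summable_comparison_test')
  show "summable (\<lambda>j. K * (inverse (fact j) * \<bar>y\<bar> ^ j))"
    by (intro summable_mult summable_exp)
  fix j
  show "norm (c j * y ^ j) \<le> K * (inverse (fact j) * \<bar>y\<bar> ^ j)"
    using mult_right_mono[OF assms[of j], of "\<bar>y\<bar> ^ j"]
    by (simp add: abs_mult power_abs divide_inverse mult.assoc)
qed

lemma hyp0F1_neg_coeff_bound:
  assumes "\<nu> > 0"
  shows "\<bar>hyp0F1_neg_coeff \<nu> j\<bar> \<le> (1 / min 1 \<nu>) / fact j"
proof -
  have "1 / (fact j * pochhammer \<nu> j) \<le> 1 / (fact j * min 1 \<nu>)"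
    using pochhammer_ge_min[OF assms, of j] assms
    by (intro divide_left_mono mult_left_mono mult_pos_pos pochhammer_pos) auto
  then show ?thesis
    using pochhammer_pos[OF assms, of j] by (simp add: hyp0F1_neg_coeff_def abs_mult field_simps)
qed

lemma summable_hyp0F1_neg_coeff: "\<nu> > 0 \<Longrightarrow> summable (\<lambda>j. hyp0F1_neg_coeff \<nu> j * y ^ j)"
  by (rule summable_of_fact_bound[OF hyp0F1_neg_coeff_bound])

lemma hyp0F1_neg_coeff_Suc:
  assumes "\<nu> > 0"
  shows "hyp0F1_neg_coeff \<nu> (Suc j) = - hyp0F1_neg_coeff (\<nu> + 1) j / (\<nu> * real (Suc j))"
  using assms by (simp add: hyp0F1_neg_coeff_def pochhammer_rec field_simps)

lemma hyp0F1_neg_0 [simp]: "hyp0F1_neg \<nu> 0 = 1"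
  by (simp only: hyp0F1_neg_def powser_zero) (simp add: hyp0F1_neg_coeff_def)

lemma hyp0F1_neg_deriv:
  assumes "\<nu> > 0"
  shows "(hyp0F1_neg \<nu> has_field_derivative - hyp0F1_neg (\<nu> + 1) y / \<nu>) (at y)"
proof -
  have "diffs (hyp0F1_neg_coeff \<nu>) j = (- 1 / \<nu>) * hyp0F1_neg_coeff (\<nu> + 1) j" for j
    using assms unfolding diffs_def hyp0F1_neg_coeff_Suc[OF assms] by simp
  then have "(\<Sum>j. diffs (hyp0F1_neg_coeff \<nu>) j * y ^ j) = (\<Sum>j. (- 1 / \<nu>) * (hyp0F1_neg_coeff (\<nu> + 1) j * y ^ j))"
    by (simp add: mult.assoc)
  also have "\<dots> = - hyp0F1_neg (\<nu> + 1) y / \<nu>"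
    using suminf_mult[OF summable_hyp0F1_neg_coeff[of "\<nu> + 1" y], of "- 1 / \<nu>"] assms
    by (simp add: hyp0F1_neg_def)
  finally show ?thesis
    using termdiffs_strong_converges_everywhere[OF summable_hyp0F1_neg_coeff[OF assms], of y]
    by (simp add: hyp0F1_neg_def[abs_def])
qed

text \<open>Since \<open>hyp0F1_neg_deriv\<close>, applied twice, expresses \<open>G'\<close> and
  \<open>G''\<close> through the parameters \<open>\<nu> + 1\<close> and \<open>\<nu> + 2\<close>,
  this is the Bessel equation \<open>y * G'' + \<nu> * G' + G = 0\<close>. It holds coefficient by
  coefficient.\<close>

lemma hyp0F1_neg_contiguous:
  assumes "\<nu> > 0"
  shows "hyp0F1_neg \<nu> y - hyp0F1_neg (\<nu> + 1) y + y * hyp0F1_neg (\<nu> + 2) y / (\<nu> * (\<nu> + 1)) = 0"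
proof -
  \<comment> \<open>Coefficients of the third term: the factor \<open>y\<close> shifts the series by
    one place, so the constant coefficient is 0.\<close>
  define e where "e j = (case j of 0 \<Rightarrow> 0 | Suc i \<Rightarrow> hyp0F1_neg_coeff (\<nu> + 2) i) / (\<nu> * (\<nu> + 1))" for j
  have "(\<lambda>i. hyp0F1_neg_coeff (\<nu> + 2) i * y ^ i) sums hyp0F1_neg (\<nu> + 2) y"
    using summable_hyp0F1_neg_coeff[of "\<nu> + 2" y] assms unfolding hyp0F1_neg_def by (auto intro!: summable_sums)
  then have "(\<lambda>i. (y / (\<nu> * (\<nu> + 1))) * (hyp0F1_neg_coeff (\<nu> + 2) i * y ^ i)) sums
      ((y / (\<nu> * (\<nu> + 1))) * hyp0F1_neg (\<nu> + 2) y)"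
    by (rule sums_mult)
  then have "(\<lambda>i. e (Suc i) * y ^ Suc i) sums (y * hyp0F1_neg (\<nu> + 2) y / (\<nu> * (\<nu> + 1)))"
    by (simp add: e_def algebra_simps)
  then have e: "(\<lambda>j. e j * y ^ j) sums (y * hyp0F1_neg (\<nu> + 2) y / (\<nu> * (\<nu> + 1)))"
    by (subst (asm) sums_Suc_iff) (simp add: e_def)
  have "(\<lambda>j. hyp0F1_neg_coeff \<nu> j * y ^ j - hyp0F1_neg_coeff (\<nu> + 1) j * y ^ j + e j * y ^ j) sums
      (hyp0F1_neg \<nu> y - hyp0F1_neg (\<nu> + 1) y + y * hyp0F1_neg (\<nu> + 2) y / (\<nu> * (\<nu> + 1)))"
    unfolding hyp0F1_neg_def[of \<nu>] hyp0F1_neg_def[of "\<nu> + 1"]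
    by (intro sums_add sums_diff e summable_sums summable_hyp0F1_neg_coeff) (use assms in auto)
  moreover have "hyp0F1_neg_coeff \<nu> j - hyp0F1_neg_coeff (\<nu> + 1) j + e j = 0" for j
  proof (cases j)
    case 0
    then show ?thesis by (simp add: e_def hyp0F1_neg_coeff_def)
  next
    case (Suc i)
    have 1: "pochhammer \<nu> (Suc i) = \<nu> * pochhammer (\<nu> + 1) i"
      "pochhammer (\<nu> + 1) (Suc i) = pochhammer (\<nu> + 1) i * (\<nu> + 1 + i)"
      by (rule pochhammer_rec, rule pochhammer_Suc)
    have 2: "(\<nu> + 1) * pochhammer (\<nu> + 2) i = pochhammer (\<nu> + 1) i * (\<nu> + 1 + i)"
      using pochhammer_rec[of "\<nu> + 1" i] pochhammer_Suc[of "\<nu> + 1" i] by (simp add: algebra_simps)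
    have p: "pochhammer (\<nu> + 1) i > 0" "pochhammer (\<nu> + 2) i > 0"
      using assms by (auto intro!: pochhammer_pos)
    have e: "e (Suc i) = (-1) ^ i / (fact i * (\<nu> * (pochhammer (\<nu> + 1) i * (\<nu> + 1 + i))))"
      using assms p by (simp add: e_def hyp0F1_neg_coeff_def 2[symmetric] mult_ac)
    show ?thesis
      unfolding Suc e hyp0F1_neg_coeff_def 1 using assms p
      by (simp add: divide_simps) (simp add: algebra_simps)
  qed
  then have "hyp0F1_neg_coeff \<nu> j * y ^ j - hyp0F1_neg_coeff (\<nu> + 1) j * y ^ j + e j * y ^ j = 0" for j
    by (metis (no_types, lifting) left_diff_distrib distrib_right mult_zero_left)
  ultimately show ?thesis
    by (simp add: sums_iff)
qed

section \<open>The Bessel energy and its consequences\<close>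

text \<open>By the Bessel equation the derivative of \<open>G^2 + y * G'^2\<close> collapses to
  \<open>(1 - 2 * \<nu>) * G'^2\<close>, which is nonpositive exactly because
  \<open>\<nu> \<ge> 1/2\<close>. The value at 0 is 1.\<close>

lemma hyp0F1_neg_energy:
  assumes "\<nu> \<ge> 1/2" "y \<ge> 0"
  shows "(hyp0F1_neg \<nu> y)\<^sup>2 + y * (hyp0F1_neg (\<nu> + 1) y / \<nu>)\<^sup>2 \<le> 1"
proof -
  define E where "E y = (hyp0F1_neg \<nu> y)\<^sup>2 + y * (hyp0F1_neg (\<nu> + 1) y / \<nu>)\<^sup>2" for y
  have deriv: "(E has_real_derivative (1 - 2 * \<nu>) * (hyp0F1_neg (\<nu> + 1) x / \<nu>)\<^sup>2) (at x)" for x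
  proof -
    have \<nu>: "\<nu> > 0" "\<nu> + 1 > 0" using assms by auto
    have b: "hyp0F1_neg \<nu> x = hyp0F1_neg (\<nu> + 1) x - x * hyp0F1_neg (\<nu> + 2) x / (\<nu> * (\<nu> + 1))"
      using hyp0F1_neg_contiguous[OF \<nu>(1), of x] by linarith
    have "(E has_real_derivative
        2 * hyp0F1_neg \<nu> x * (- hyp0F1_neg (\<nu> + 1) x / \<nu>) + ((hyp0F1_neg (\<nu> + 1) x / \<nu>)\<^sup>2 +
        x * (2 * (hyp0F1_neg (\<nu> + 1) x / \<nu>) * (- hyp0F1_neg (\<nu> + 1 + 1) x / (\<nu> + 1) / \<nu>)))) (at x)"
      unfolding E_def[abs_def]
      by (auto intro!: derivative_eq_intros hyp0F1_neg_deriv[OF \<nu>(1)] hyp0F1_neg_deriv[OF \<nu>(2)])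
        (use \<nu> in \<open>auto simp: field_simps power2_eq_square\<close>)
    moreover have "2 * hyp0F1_neg \<nu> x * (- hyp0F1_neg (\<nu> + 1) x / \<nu>) + ((hyp0F1_neg (\<nu> + 1) x / \<nu>)\<^sup>2 +
        x * (2 * (hyp0F1_neg (\<nu> + 1) x / \<nu>) * (- hyp0F1_neg (\<nu> + 1 + 1) x / (\<nu> + 1) / \<nu>)))
        = (1 - 2 * \<nu>) * (hyp0F1_neg (\<nu> + 1) x / \<nu>)\<^sup>2"
    proof -
      \<comment> \<open>Here \<open>p\<close> is \<open>- G'\<close> and \<open>q\<close> is
        \<open>G''\<close>. Once the Bessel equation is solved for \<open>G\<close>, the claim is a
        polynomial identity in \<open>p\<close>, \<open>q\<close>, \<open>x\<close> and
        \<open>\<nu>\<close>.\<close>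
      define p q where "p = hyp0F1_neg (\<nu> + 1) x / \<nu>" and "q = hyp0F1_neg (\<nu> + 1 + 1) x / (\<nu> + 1) / \<nu>"
      have 1: "hyp0F1_neg \<nu> x = \<nu> * p - x * q"
        using \<nu> b by (simp add: p_def q_def add.assoc mult.commute)
      have 2: "hyp0F1_neg (\<nu> + 1) x / \<nu> = p" "- hyp0F1_neg (\<nu> + 1) x / \<nu> = - p"
        "- hyp0F1_neg (\<nu> + 1 + 1) x / (\<nu> + 1) / \<nu> = - q"
        by (simp_all add: p_def q_def)
      show ?thesis
        unfolding 1 2 by algebra
    qed
    ultimately show ?thesis by simp
  qed
  have "E y \<le> E 0"
  proof (rule DERIV_nonpos_imp_nonincreasing[OF assms(2)], intro exI conjI)
    show "(1 - 2 * \<nu>) * (hyp0F1_neg (\<nu> + 1) x / \<nu>)\<^sup>2 \<le> 0" for x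
      using assms by (intro mult_nonpos_nonneg) auto
  qed (rule deriv)
  then show ?thesis by (simp add: E_def)
qed

lemma abs_hyp0F1_neg_le_1:
  assumes "\<nu> \<ge> 1/2" "y \<ge> 0"
  shows "\<bar>hyp0F1_neg \<nu> y\<bar> \<le> 1"
proof -
  have "0 \<le> y * (hyp0F1_neg (\<nu> + 1) y / \<nu>)\<^sup>2" using assms by simp
  then have "(hyp0F1_neg \<nu> y)\<^sup>2 \<le> 1" using hyp0F1_neg_energy[OF assms] by linarith
  then show ?thesis by (simp add: abs_square_le_1)
qed

lemma abs_hyp0F1_neg_deriv_le:
  assumes "\<nu> \<ge> 1/2" "y > 0"
  shows "\<bar>hyp0F1_neg (\<nu> + 1) y / \<nu>\<bar> \<le> 1 / sqrt y"
proof -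
  have "y * (hyp0F1_neg (\<nu> + 1) y / \<nu>)\<^sup>2 \<le> 1"
    using hyp0F1_neg_energy[of \<nu> y] assms zero_le_power2[of "hyp0F1_neg \<nu> y"] by linarith
  then have "(hyp0F1_neg (\<nu> + 1) y / \<nu>)\<^sup>2 \<le> 1 / y"
    using assms by (simp add: field_simps)
  then have "sqrt ((hyp0F1_neg (\<nu> + 1) y / \<nu>)\<^sup>2) \<le> sqrt (1 / y)"
    by (rule real_sqrt_le_mono)
  then show ?thesis by (simp only: real_sqrt_abs real_sqrt_divide real_sqrt_one)
qed

text \<open>The derivative of \<open>\<nu> * G + y\<close> is 1 minus the function with parameter
  \<open>\<nu> + 1\<close>, hence nonnegative by the energy bound for that parameter. Compare the
  values at 0 and \<open>y\<close>.\<close>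

lemma one_minus_hyp0F1_neg_le:
  assumes "\<nu> \<ge> 1/2" "y \<ge> 0"
  shows "\<nu> * (1 - hyp0F1_neg \<nu> y) \<le> y"
proof -
  have "\<nu> * hyp0F1_neg \<nu> 0 + 0 \<le> \<nu> * hyp0F1_neg \<nu> y + y"
  proof (rule DERIV_nonneg_imp_nondecreasing[OF assms(2)], intro exI conjI)
    fix x :: real assume x: "0 \<le> x" "x \<le> y"
    show "((\<lambda>x. \<nu> * hyp0F1_neg \<nu> x + x) has_real_derivative 1 - hyp0F1_neg (\<nu> + 1) x) (at x)"
      using assms by (auto intro!: derivative_eq_intros hyp0F1_neg_deriv)
    show "1 - hyp0F1_neg (\<nu> + 1) x \<ge> 0"
      using abs_hyp0F1_neg_le_1[of "\<nu> + 1" x] x assms by auto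
  qed
  then show ?thesis by (simp add: algebra_simps)
qed

section \<open>The 2F3 series and its first order equation\<close>

definition hyp2F3_neg_coeff :: "real \<Rightarrow> real \<Rightarrow> nat \<Rightarrow> real" where
  "hyp2F3_neg_coeff a \<nu> j = (pochhammer 1 j * pochhammer a j) /
     (pochhammer 2 j * pochhammer (\<nu> + 1) j * pochhammer (a + 1) j) * ((-1) ^ j / fact j)"

definition hyp2F3_neg :: "real \<Rightarrow> real \<Rightarrow> real \<Rightarrow> real" where
  "hyp2F3_neg a \<nu> y = (\<Sum>j. hyp2F3_neg_coeff a \<nu> j * y ^ j)"

lemma hyp2F3_uminus: "hyp2F3 1 a 2 (\<nu> + 1) (a + 1) (- y) = hyp2F3_neg a \<nu> y"
  unfolding hyp2F3_def hyp2F3_neg_def hyp2F3_neg_coeff_def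
  by (subst power_minus[of y]) (simp add: mult_ac)

lemma hyp2F3_neg_coeff_0 [simp]: "hyp2F3_neg_coeff a \<nu> 0 = 1"
  by (simp add: hyp2F3_neg_coeff_def)

text \<open>The parameters \<open>a\<close> and \<open>a + 1\<close> combine to
  \<open>a / (a + j)\<close>, while 1 and 2 combine to \<open>1 / (j + 1)\<close>; what remains is a
  shifted 0F1 coefficient. Keeping \<open>a + real j\<close> as a factor covers
  \<open>a = 0\<close>, \<open>j = 0\<close> as well.\<close>

lemma hyp2F3_neg_coeff_eq:
  assumes "a > -1" "\<nu> > 0"
  shows "(a + real j) * hyp2F3_neg_coeff a \<nu> j = - a * \<nu> * hyp0F1_neg_coeff \<nu> (Suc j)"
proof -
  have p: "pochhammer (a + 1) j > 0" "pochhammer (\<nu> + 1) j > 0" "pochhammer (2::real) j > 0"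
    using assms by (auto intro!: pochhammer_pos)
  have 1: "(a + real j) * pochhammer a j = a * pochhammer (a + 1) j"
    using pochhammer_rec[of a j] pochhammer_Suc[of a j] by (simp add: algebra_simps)
  have 2: "pochhammer 2 j = (fact (Suc j) :: real)"
    using pochhammer_rec[of "1::real" j] by (simp add: pochhammer_fact)
  have 3: "pochhammer 1 j = (fact j :: real)"
    by (simp add: pochhammer_fact)
  have "(a + real j) * hyp2F3_neg_coeff a \<nu> j = ((a + real j) * pochhammer a j) * (-1) ^ j /
      (fact (Suc j) * pochhammer (\<nu> + 1) j * pochhammer (a + 1) j)"
    unfolding hyp2F3_neg_coeff_def 2 3 by (simp add: field_simps)
  also have "\<dots> = a * (-1) ^ j / (fact (Suc j) * pochhammer (\<nu> + 1) j)"
    unfolding 1 using p by simp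
  also have "\<dots> = - a * \<nu> * hyp0F1_neg_coeff \<nu> (Suc j)"
    using assms p by (simp add: hyp0F1_neg_coeff_def pochhammer_rec)
  finally show ?thesis .
qed

text \<open>For \<open>j \<ge> 1\<close> the factor \<open>a + j\<close> is at least
  \<open>a + 1 > 0\<close> and can be divided out uniformly. The summand 1 in the constant pays for
  \<open>j = 0\<close>, where \<open>a + j\<close> need not be positive.\<close>

lemma hyp2F3_neg_coeff_bound:
  assumes "a > -1" "\<nu> > 0"
  shows "\<bar>hyp2F3_neg_coeff a \<nu> j\<bar> \<le> (1 + \<bar>a\<bar> * \<nu> * (1 / min 1 \<nu>) / (a + 1)) / fact j"
proof (cases j)
  case 0
  then show ?thesis using assms by simp
next
  case (Suc i)
  have "(a + real j) * \<bar>hyp2F3_neg_coeff a \<nu> j\<bar> = \<bar>a\<bar> * \<nu> * \<bar>hyp0F1_neg_coeff \<nu> (Suc j)\<bar>"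
    using arg_cong[OF hyp2F3_neg_coeff_eq[OF assms, of j], of abs] assms Suc by (simp add: abs_mult)
  also have "\<dots> \<le> \<bar>a\<bar> * \<nu> * ((1 / min 1 \<nu>) / fact (Suc j))"
    using assms by (intro mult_left_mono hyp0F1_neg_coeff_bound) auto
  also have "\<dots> \<le> \<bar>a\<bar> * \<nu> * ((1 / min 1 \<nu>) / fact j)"
    using assms by (intro mult_left_mono divide_left_mono fact_mono) auto
  finally have *: "(a + real j) * \<bar>hyp2F3_neg_coeff a \<nu> j\<bar> \<le> \<bar>a\<bar> * \<nu> * (1 / min 1 \<nu>) / fact j" by simp
  have "(a + 1) * \<bar>hyp2F3_neg_coeff a \<nu> j\<bar> \<le> (a + real j) * \<bar>hyp2F3_neg_coeff a \<nu> j\<bar>"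
    using Suc by (intro mult_right_mono) auto
  also note *
  finally have "\<bar>hyp2F3_neg_coeff a \<nu> j\<bar> \<le> (\<bar>a\<bar> * \<nu> * (1 / min 1 \<nu>) / fact j) / (a + 1)"
    using assms by (subst pos_le_divide_eq) (auto simp: mult.commute)
  also have "\<dots> = (\<bar>a\<bar> * \<nu> * (1 / min 1 \<nu>) / (a + 1)) / fact j"
    by simp
  also have "\<dots> \<le> (1 + \<bar>a\<bar> * \<nu> * (1 / min 1 \<nu>) / (a + 1)) / fact j"
    by (intro divide_right_mono) auto
  finally show ?thesis .
qed

lemma summable_hyp2F3_neg_coeff: "a > -1 \<Longrightarrow> \<nu> > 0 \<Longrightarrow> summable (\<lambda>j. hyp2F3_neg_coeff a \<nu> j * y ^ j)"
  by (rule summable_of_fact_bound[OF hyp2F3_neg_coeff_bound])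

lemma hyp2F3_neg_0 [simp]: "hyp2F3_neg a \<nu> 0 = 1"
  by (simp only: hyp2F3_neg_def powser_zero hyp2F3_neg_coeff_0)

lemma hyp2F3_neg_deriv:
  assumes "a > -1" "\<nu> > 0"
  shows "(hyp2F3_neg a \<nu> has_real_derivative (\<Sum>j. diffs (hyp2F3_neg_coeff a \<nu>) j * y ^ j)) (at y)"
  using termdiffs_strong_converges_everywhere[OF summable_hyp2F3_neg_coeff[OF assms], of y]
  by (simp add: hyp2F3_neg_def[abs_def])

text \<open>The first order equation degenerates at 0, so the derivative there is read off the
  linear coefficient. It yields continuity at 0 and, for \<open>a < 0\<close>, growth above the
  value 1.\<close>

lemma hyp2F3_neg_deriv_0:
  assumes "a > -1" "\<nu> > 0"
  shows "(hyp2F3_neg a \<nu> has_real_derivative - a / ((a + 1) * 2 * (\<nu> + 1))) (at 0)"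
proof -
  have "(\<Sum>j. diffs (hyp2F3_neg_coeff a \<nu>) j * 0 ^ j) = - a / ((a + 1) * 2 * (\<nu> + 1))"
    unfolding powser_zero by (simp add: diffs_def hyp2F3_neg_coeff_def)
  then show ?thesis
    using hyp2F3_neg_deriv[OF assms, of 0] by simp
qed

text \<open>Multiplication by \<open>y\<close> turns the coefficients of \<open>F'\<close> into
  \<open>j\<close> times those of \<open>F\<close>. Adding \<open>a * F\<close> produces the factor
  \<open>a + j\<close> of \<open>hyp2F3_neg_coeff_eq\<close>, and the sum becomes the 0F1 series
  without its constant term 1.\<close>

lemma hyp2F3_neg_deriv_pos:
  assumes "a > -1" "\<nu> > 0" "y > 0"
  shows "(hyp2F3_neg a \<nu> has_real_derivative (a * \<nu> * (1 - hyp0F1_neg \<nu> y) / y - a * hyp2F3_neg a \<nu> y) / y) (at y)"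
proof -
  define D where "D = (\<Sum>j. diffs (hyp2F3_neg_coeff a \<nu>) j * y ^ j)"
  have "summable (\<lambda>j. diffs (hyp2F3_neg_coeff a \<nu>) j * y ^ j)"
    by (rule termdiff_converges_all) (rule summable_hyp2F3_neg_coeff[OF assms(1,2)])
  then have "(\<lambda>j. diffs (hyp2F3_neg_coeff a \<nu>) j * y ^ j) sums D"
    unfolding D_def by (rule summable_sums)
  then have "(\<lambda>j. y * (diffs (hyp2F3_neg_coeff a \<nu>) j * y ^ j)) sums (y * D)"
    by (rule sums_mult)
  then have "(\<lambda>j. real (Suc j) * hyp2F3_neg_coeff a \<nu> (Suc j) * y ^ Suc j) sums (y * D)"
    by (simp add: diffs_def mult_ac)
  then have "(\<lambda>j. real j * hyp2F3_neg_coeff a \<nu> j * y ^ j) sums (y * D)"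
    by (subst (asm) sums_Suc_iff) simp
  moreover have "(\<lambda>j. a * (hyp2F3_neg_coeff a \<nu> j * y ^ j)) sums (a * hyp2F3_neg a \<nu> y)"
    unfolding hyp2F3_neg_def by (intro sums_mult summable_sums summable_hyp2F3_neg_coeff assms)
  ultimately have "(\<lambda>j. real j * hyp2F3_neg_coeff a \<nu> j * y ^ j + a * (hyp2F3_neg_coeff a \<nu> j * y ^ j)) sums
      (y * D + a * hyp2F3_neg a \<nu> y)"
    by (rule sums_add)
  moreover have "real j * hyp2F3_neg_coeff a \<nu> j * y ^ j + a * (hyp2F3_neg_coeff a \<nu> j * y ^ j) =
      - a * \<nu> / y * (hyp0F1_neg_coeff \<nu> (Suc j) * y ^ Suc j)" for j
  proof -
    have "real j * hyp2F3_neg_coeff a \<nu> j * y ^ j + a * (hyp2F3_neg_coeff a \<nu> j * y ^ j) =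
       ((a + real j) * hyp2F3_neg_coeff a \<nu> j) * y ^ j" by (simp add: algebra_simps)
    then show ?thesis
      unfolding hyp2F3_neg_coeff_eq[OF assms(1,2)] using assms by simp
  qed
  ultimately have 1: "(\<lambda>j. - a * \<nu> / y * (hyp0F1_neg_coeff \<nu> (Suc j) * y ^ Suc j)) sums (y * D + a * hyp2F3_neg a \<nu> y)"
    by simp
  have "(\<lambda>j. hyp0F1_neg_coeff \<nu> j * y ^ j) sums hyp0F1_neg \<nu> y"
    unfolding hyp0F1_neg_def by (intro summable_sums summable_hyp0F1_neg_coeff assms)
  then have "(\<lambda>j. hyp0F1_neg_coeff \<nu> (Suc j) * y ^ Suc j) sums (hyp0F1_neg \<nu> y - 1)"
    by (subst sums_Suc_iff) (simp add: hyp0F1_neg_coeff_def)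
  then have "(\<lambda>j. - a * \<nu> / y * (hyp0F1_neg_coeff \<nu> (Suc j) * y ^ Suc j)) sums (- a * \<nu> / y * (hyp0F1_neg \<nu> y - 1))"
    by (rule sums_mult)
  then have "y * D + a * hyp2F3_neg a \<nu> y = - a * \<nu> / y * (hyp0F1_neg \<nu> y - 1)"
    using 1 sums_unique2 by blast
  then have "D = (a * \<nu> * (1 - hyp0F1_neg \<nu> y) / y - a * hyp2F3_neg a \<nu> y) / y"
    using assms by (simp add: field_simps)
  then show ?thesis
    using hyp2F3_neg_deriv[OF assms(1,2), of y] by (simp add: D_def)
qed

section \<open>Lower bounds\<close>

text \<open>Up to \<open>Y\<close> the weight \<open>(1 + y) powr q\<close> is bounded, and beyond
  \<open>Y\<close> it is comparable to \<open>y powr q\<close>. Taking \<open>\<bar>q\<bar>\<close>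
  in the constants treats both signs of \<open>q\<close> at once.\<close>

lemma lower_bound_glue:
  fixes f :: "real \<Rightarrow> real"
  assumes Y: "Y > 0" and c: "c1 > 0" "c2 > 0"
    and near: "\<And>y. 0 \<le> y \<Longrightarrow> y \<le> Y \<Longrightarrow> c1 \<le> f y"
    and far: "\<And>y. Y \<le> y \<Longrightarrow> c2 * y powr q \<le> f y"
  shows "\<exists>c>0. \<forall>y\<ge>0. c * (1 + y) powr q \<le> f y"
proof -
  define K1 K2 where "K1 = (1 + Y) powr \<bar>q\<bar>" and "K2 = (1 + 1 / Y) powr \<bar>q\<bar>"
  have K: "K1 > 0" "K2 > 0"
    using Y by (auto simp: K1_def K2_def intro!: less_imp_neq[symmetric] add_pos_pos)
  define c where "c = min (c1 / K1) (c2 / K2)"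
  have "c * (1 + y) powr q \<le> f y" if y: "y \<ge> 0" for y
  proof (cases "y \<le> Y")
    case True
    have "(1 + y) powr q \<le> (1 + y) powr \<bar>q\<bar>"
      using y by (intro powr_mono) auto
    also have "\<dots> \<le> K1"
      unfolding K1_def using y True by (intro powr_mono2) auto
    finally have "c * (1 + y) powr q \<le> c1 / K1 * K1"
      using c K by (intro mult_mono) (auto simp: c_def)
    then show ?thesis using near[OF y True] K by simp
  next
    case False
    have "(1 + y) powr q = (y * (1 + 1 / y)) powr q"
      using False Y by (simp add: distrib_left add.commute)
    also have "\<dots> = y powr q * (1 + 1 / y) powr q"
      by (rule powr_mult)
    also have "(1 + 1 / y) powr q \<le> (1 + 1 / y) powr \<bar>q\<bar>"
      using False Y by (intro powr_mono) auto
    also have "(1 + 1 / y) powr \<bar>q\<bar> \<le> K2"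
      unfolding K2_def using False Y by (intro powr_mono2) (auto simp: field_simps)
    finally have "c * (1 + y) powr q \<le> c2 / K2 * (y powr q * K2)"
      using c K by (intro mult_mono) (auto simp: c_def mult_left_mono)
    then show ?thesis using far[of y] False K by simp
  qed
  moreover have "c > 0" using c K by (simp add: c_def)
  ultimately show ?thesis by blast
qed

text \<open>For \<open>a < 0\<close> the function \<open>y powr a * F\<close> itself decreases.
  Subtracting 1 from \<open>F\<close> repairs this: the derivative becomes a product of two
  nonpositive factors, the second one by \<open>one_minus_hyp0F1_neg_le\<close>.\<close>

lemma hyp2F3_neg_lower_bound_neg:
  assumes a: "-1 < a" "a < 0" and \<nu>: "\<nu> \<ge> 1/2"
  shows "\<exists>c>0. \<forall>y\<ge>0. c * (1 + y) powr (- a) \<le> hyp2F3_neg a \<nu> y"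
proof -
  have pos: "\<nu> > 0" using \<nu> by simp
  \<comment> \<open>A positive slope at 0 provides a point \<open>Y\<close> with
    \<open>F Y > 1\<close>, so that the monotone quantity starts from a positive value
    \<open>c\<close>.\<close>
  have "- a / ((a + 1) * 2 * (\<nu> + 1)) > 0"
    using a pos by (intro divide_pos_pos mult_pos_pos) auto
  then obtain d where d: "d > 0" "\<And>h. 0 < h \<Longrightarrow> h < d \<Longrightarrow> hyp2F3_neg a \<nu> 0 < hyp2F3_neg a \<nu> (0 + h)"
    using DERIV_pos_inc_right[OF hyp2F3_neg_deriv_0[OF a(1) pos]] by blast
  define Y where "Y = d / 2"
  have Y: "Y > 0" "hyp2F3_neg a \<nu> Y > 1" using d by (auto simp: Y_def)
  define c where "c = Y powr a * (hyp2F3_neg a \<nu> Y - 1)"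
  show ?thesis
  proof (rule lower_bound_glue[OF Y(1) zero_less_one])
    show "c > 0" using Y by (simp add: c_def)
    fix y
    show "1 \<le> hyp2F3_neg a \<nu> y" if "0 \<le> y" "y \<le> Y"
      using d(2)[of y] that Y(1) by (cases "y = 0") (auto simp: Y_def)
    assume y: "Y \<le> y"
    have "c \<le> y powr a * (hyp2F3_neg a \<nu> y - 1)"
      unfolding c_def
    proof (rule DERIV_nonneg_imp_nondecreasing[OF y], intro exI conjI)
      fix x assume x: "Y \<le> x" "x \<le> y"
      then have x0: "x > 0" using Y by simp
      show "((\<lambda>x. x powr a * (hyp2F3_neg a \<nu> x - 1)) has_real_derivative
          a * x powr (a - 1) * (\<nu> * (1 - hyp0F1_neg \<nu> x) / x - 1)) (at x)"
        using x0 has_real_derivative_powr[OF x0, of a]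
        by (auto intro!: derivative_eq_intros hyp2F3_neg_deriv_pos[OF a(1) pos])
          (simp add: powr_diff field_simps)
      have "\<nu> * (1 - hyp0F1_neg \<nu> x) / x - 1 \<le> 0"
        using one_minus_hyp0F1_neg_le[OF \<nu>, of x] x0 by simp
      moreover have "a * x powr (a - 1) \<le> 0"
        using a by (intro mult_nonpos_nonneg) auto
      ultimately show "0 \<le> a * x powr (a - 1) * (\<nu> * (1 - hyp0F1_neg \<nu> x) / x - 1)"
        by (rule mult_nonpos_nonpos[rotated])
    qed
    then have "c * y powr (- a) \<le> hyp2F3_neg a \<nu> y - 1"
      using y Y by (simp add: powr_minus field_simps)
    then show "c * y powr (- a) \<le> hyp2F3_neg a \<nu> y" by simp
  qed
qed

text \<open>The power of \<open>x\<close> is the integrating factor of the first order equation: it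
  removes the term \<open>a * F\<close>.\<close>

lemma powr_hyp2F3_neg_deriv:
  assumes "a > -1" "\<nu> > 0" "x > 0"
  shows "((\<lambda>x. x powr a * hyp2F3_neg a \<nu> x) has_real_derivative
      a * \<nu> * x powr (a - 2) * (1 - hyp0F1_neg \<nu> x)) (at x)"
  using has_real_derivative_powr[OF assms(3), of a] assms(3)
  by (auto intro!: derivative_eq_intros hyp2F3_neg_deriv_pos[OF assms])
    (simp add: powr_diff power2_eq_square field_simps)

text \<open>Because \<open>G \<le> 1\<close>, the function \<open>y powr a * F\<close> increases,
  starting from a point \<open>Y\<close> so close to 0 that \<open>F \<ge> 1/2\<close> by
  continuity. The order \<open>- a\<close> is the required one for \<open>a \<le> 1\<close>; for
  larger \<open>a\<close> these bounds serve on a bounded range.\<close>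

lemma hyp2F3_neg_lower_bound_pos:
  assumes a: "a > 0" and \<nu>: "\<nu> \<ge> 1/2"
  obtains Y c where "Y > 0" "c > 0"
    "\<And>y. 0 \<le> y \<Longrightarrow> y \<le> Y \<Longrightarrow> 1/2 \<le> hyp2F3_neg a \<nu> y"
    "\<And>y. Y \<le> y \<Longrightarrow> c * y powr (- a) \<le> hyp2F3_neg a \<nu> y"
proof -
  have pos: "\<nu> > 0" "a > -1" using \<nu> a by auto
  have "hyp2F3_neg a \<nu> \<midarrow>0\<rightarrow> hyp2F3_neg a \<nu> 0"
    using DERIV_isCont[OF hyp2F3_neg_deriv_0[OF pos(2,1)]] by (simp add: isCont_def)
  then have "\<forall>\<^sub>F y in at 0. 1/2 < hyp2F3_neg a \<nu> y"
    by (rule order_tendstoD) simp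
  then obtain d where d: "d > 0" "\<And>y. y \<noteq> 0 \<Longrightarrow> \<bar>y\<bar> < d \<Longrightarrow> 1/2 < hyp2F3_neg a \<nu> y"
    by (auto simp: eventually_at)
  define Y where "Y = d / 2"
  have Y: "Y > 0" using d by (simp add: Y_def)
  have near: "1/2 \<le> hyp2F3_neg a \<nu> y" if "0 \<le> y" "y \<le> Y" for y
    using d(1) d(2)[of y] that by (cases "y = 0") (auto simp: Y_def)
  define c where "c = Y powr a * hyp2F3_neg a \<nu> Y"
  show ?thesis
  proof (rule that[OF Y])
    show "c > 0" using near[of Y] Y by (simp add: c_def)
    show "1/2 \<le> hyp2F3_neg a \<nu> y" if "0 \<le> y" "y \<le> Y" for y by (rule near[OF that])
    fix y assume y: "Y \<le> y"
    have "c \<le> y powr a * hyp2F3_neg a \<nu> y"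
      unfolding c_def
    proof (rule DERIV_nonneg_imp_nondecreasing[OF y], intro exI conjI)
      fix x assume x: "Y \<le> x" "x \<le> y"
      show "((\<lambda>x. x powr a * hyp2F3_neg a \<nu> x) has_real_derivative
          a * \<nu> * x powr (a - 2) * (1 - hyp0F1_neg \<nu> x)) (at x)"
        using x Y by (intro powr_hyp2F3_neg_deriv pos) auto
      show "0 \<le> a * \<nu> * x powr (a - 2) * (1 - hyp0F1_neg \<nu> x)"
        using abs_hyp0F1_neg_le_1[OF \<nu>, of x] x Y a pos by (intro mult_nonneg_nonneg) auto
    qed
    then show "c * y powr (- a) \<le> hyp2F3_neg a \<nu> y"
      using y Y by (simp add: powr_minus field_simps)
  qed
qed

text \<open>
  Here \<open>y powr a * F\<close> being increasing only gives \<open>F \<ge> c * y powr (- a)\<close>. The Bessel equation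
  turns \<open>- y powr (a - 2) * G\<close> into the derivative of \<open>y powr (a - 1) * G'\<close> plus an error of
  lower order, by \<open>\<bar>G'\<bar> \<le> 1 / sqrt y\<close>. Hence \<open>P\<close> below is eventually increasing.
\<close>

lemma hyp2F3_neg_lower_bound_gt_1_eventually:
  assumes a: "a > 1" and \<nu>: "\<nu> \<ge> 1/2"
  obtains c where "c > 0" "\<forall>\<^sub>F y in at_top. c \<le> y * hyp2F3_neg a \<nu> y"
proof -
  have pos: "\<nu> > 0" "a > -1" using \<nu> a by auto
  \<comment> \<open>Chosen so that \<open>K * x powr (a - 1)\<close> has half of the main term
    \<open>a * \<nu> * x powr (a - 2)\<close> as its derivative; the other half absorbs the
    error.\<close>
  define K where "K = a * \<nu> / 2 / (a - 1)"
  have K: "K > 0" "K * (a - 1) = a * \<nu> / 2"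
    using a pos nonzero_eq_divide_eq[of "a - 1" K "a * \<nu> / 2"] by (auto simp: K_def)
  \<comment> \<open>For \<open>x \<ge> Y\<close> this makes the error
    \<open>\<bar>\<nu> - a + 1\<bar> / sqrt x\<close> at most \<open>1/2\<close>.\<close>
  define Y where "Y = 4 * (\<nu> - a + 1)\<^sup>2 + 1"
  have Y: "Y \<ge> 1" by (simp add: Y_def)
  define B where "B x = hyp0F1_neg (\<nu> + 1) x / \<nu>" for x
  \<comment> \<open>As \<open>B\<close> is \<open>- G'\<close>, the middle term cancels the second
    derivative that the Bessel equation brings in for \<open>G\<close>; only a multiple of
    \<open>B\<close> survives.\<close>
  define P where "P x = x powr a * hyp2F3_neg a \<nu> x + a * \<nu> * (x powr (a - 1) * B x) - K * x powr (a - 1)" for x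
  have mono: "P Y \<le> P y" if y: "Y \<le> y" for y
  proof (rule DERIV_nonneg_imp_nondecreasing[OF y], intro exI conjI)
    fix x assume x: "Y \<le> x" "x \<le> y"
    then have x0: "x > 0" using Y by simp
    define q where "q = hyp0F1_neg (\<nu> + 2) x / (\<nu> + 1) / \<nu>"
    have B': "(B has_real_derivative - q) (at x)"
      unfolding B_def[abs_def] q_def using pos hyp0F1_neg_deriv[of "\<nu> + 1" x]
      by (auto intro!: derivative_eq_intros simp: add.commute)
    have G: "hyp0F1_neg \<nu> x = \<nu> * B x - x * q"
      using hyp0F1_neg_contiguous[OF pos(1), of x] pos by (simp add: B_def q_def mult.commute)
    have "(P has_real_derivative
        a * \<nu> * x powr (a - 2) * (1 - hyp0F1_neg \<nu> x) +
        a * \<nu> * ((a - 1) * x powr (a - 1 - 1) * B x + (- q) * x powr (a - 1)) -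
        K * ((a - 1) * x powr (a - 1 - 1))) (at x)"
      unfolding P_def[abs_def]
      by (intro DERIV_diff DERIV_add DERIV_cmult DERIV_mult powr_hyp2F3_neg_deriv pos x0 B'
          has_real_derivative_powr)
    moreover have e: "x powr (a - 1 - 1) = x powr (a - 2)" "x powr (a - 1) = x * x powr (a - 2)"
      using x0 by (auto simp: powr_diff power2_eq_square)
    moreover have "K * ((a - 1) * x powr (a - 2)) = a * \<nu> / 2 * x powr (a - 2)"
      by (simp only: K(2) mult.assoc[symmetric])
    ultimately show "(P has_real_derivative a * \<nu> * x powr (a - 2) * (1/2 - (\<nu> - a + 1) * B x)) (at x)"
      by (simp only: G e) (simp add: algebra_simps)
    have "(\<nu> - a + 1) * B x \<le> \<bar>\<nu> - a + 1\<bar> * \<bar>B x\<bar>"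
      by (metis abs_ge_self abs_mult)
    also have "\<dots> \<le> \<bar>\<nu> - a + 1\<bar> * (1 / sqrt x)"
      unfolding B_def by (intro mult_left_mono abs_hyp0F1_neg_deriv_le \<nu> x0) auto
    also have "\<dots> \<le> 1/2"
    proof -
      have "(2 * \<bar>\<nu> - a + 1\<bar>)\<^sup>2 \<le> x"
        using x unfolding Y_def power_mult_distrib by simp
      then have "2 * \<bar>\<nu> - a + 1\<bar> \<le> sqrt x" by (rule real_le_rsqrt)
      then show ?thesis using x0 by (simp add: field_simps)
    qed
    finally show "0 \<le> a * \<nu> * x powr (a - 2) * (1/2 - (\<nu> - a + 1) * B x)"
      using a pos by (intro mult_nonneg_nonneg) auto
  qed
  \<comment> \<open>\<open>P Y \<le> P y\<close> divided by \<open>y powr (a - 1)\<close>. Apart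
    from \<open>K\<close>, the terms on the left vanish at infinity, since
    \<open>a > 1\<close>.\<close>
  have lower: "K - a * \<nu> / sqrt y + P Y * y powr (- (a - 1)) \<le> y * hyp2F3_neg a \<nu> y" if y: "Y \<le> y" for y
  proof -
    have y0: "y > 0" using y Y by simp
    have e: "y powr a = y * y powr (a - 1)" "y powr (- (a - 1)) * y powr (a - 1) = 1"
      using y0 by (auto simp: powr_diff powr_minus)
    have "a * \<nu> * (y powr (a - 1) * B y) \<le> a * \<nu> * (y powr (a - 1) * (1 / sqrt y))"
      using order_trans[OF abs_ge_self abs_hyp0F1_neg_deriv_le[OF \<nu> y0]] a pos unfolding B_def
      by (intro mult_left_mono) auto
    then have "P Y \<le> y powr (a - 1) * (y * hyp2F3_neg a \<nu> y + a * \<nu> / sqrt y - K)"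
      using mono[OF y] by (simp add: P_def e(1) algebra_simps)
    then have "y powr (- (a - 1)) * P Y \<le>
        y powr (- (a - 1)) * (y powr (a - 1) * (y * hyp2F3_neg a \<nu> y + a * \<nu> / sqrt y - K))"
      by (rule mult_left_mono) simp
    also have "\<dots> = y * hyp2F3_neg a \<nu> y + a * \<nu> / sqrt y - K"
      by (simp only: e mult.assoc[symmetric] mult_1)
    finally show ?thesis by (simp add: mult.commute)
  qed
  have "((\<lambda>y. K - a * \<nu> / sqrt y + P Y * y powr (- (a - 1))) \<longlongrightarrow> K - 0 + P Y * 0) at_top"
    using a by (intro tendsto_intros tendsto_neg_powr tendsto_divide_0[OF tendsto_const]
        filterlim_at_top_imp_at_infinity sqrt_at_top filterlim_ident) auto
  then have "\<forall>\<^sub>F y in at_top. K / 2 < K - a * \<nu> / sqrt y + P Y * y powr (- (a - 1))"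
    by (rule order_tendstoD) (use K in auto)
  then have "\<forall>\<^sub>F y in at_top. K / 2 \<le> y * hyp2F3_neg a \<nu> y"
    using eventually_ge_at_top[of Y] by eventually_elim (rule order_trans[OF less_imp_le lower])
  then show ?thesis using K by (intro that[of "K / 2"]) auto
qed

lemma hyp2F3_neg_lower_bound:
  assumes a: "a > -1" and \<nu>: "\<nu> \<ge> 1/2"
  shows "\<exists>c>0. \<forall>y\<ge>0. c * (1 + y) powr (max (-1) (- a)) \<le> hyp2F3_neg a \<nu> y"
proof -
  consider "a < 0" | "a = 0" | "a > 0" "a \<le> 1" | "a > 1" by linarith
  then show ?thesis
  proof cases
    case 1
    then show ?thesis using hyp2F3_neg_lower_bound_neg[OF a 1 \<nu>] by (simp add: max_def)
  next
    case 2
    \<comment> \<open>For \<open>a = 0\<close> every coefficient of positive index contains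
      \<open>pochhammer 0 j = 0\<close>, so \<open>F\<close> is constantly 1.\<close>
    have "hyp2F3_neg 0 \<nu> y = (\<Sum>j. hyp2F3_neg_coeff 0 \<nu> j * (if j = 0 then 1 else 0))" for y
      unfolding hyp2F3_neg_def by (intro suminf_cong) (simp add: hyp2F3_neg_coeff_def pochhammer_0_left)
    also have "\<dots> = (\<Sum>j. hyp2F3_neg_coeff 0 \<nu> j * 0 ^ j)" for y :: real
      by (intro suminf_cong) simp
    also have "\<dots> = 1" by (simp only: powser_zero hyp2F3_neg_coeff_0)
    finally have "hyp2F3_neg 0 \<nu> y = 1" for y .
    then show ?thesis using 2 by (intro exI[of _ 1]) simp
  next
    case 3
    obtain Y c where "Y > 0" "c > 0"
      "\<And>y. 0 \<le> y \<Longrightarrow> y \<le> Y \<Longrightarrow> 1/2 \<le> hyp2F3_neg a \<nu> y"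
      "\<And>y. Y \<le> y \<Longrightarrow> c * y powr (- a) \<le> hyp2F3_neg a \<nu> y"
      using hyp2F3_neg_lower_bound_pos[OF 3(1) \<nu>] by metis
    then have "\<exists>c>0. \<forall>y\<ge>0. c * (1 + y) powr (- a) \<le> hyp2F3_neg a \<nu> y"
      by (intro lower_bound_glue[of Y "1/2" c]) auto
    then show ?thesis using 3 by (simp add: max_def)
  next
    case 4
    then have a0: "a > 0" by simp
    obtain Y c where Y: "Y > 0" "c > 0"
      "\<And>y. 0 \<le> y \<Longrightarrow> y \<le> Y \<Longrightarrow> 1/2 \<le> hyp2F3_neg a \<nu> y"
      "\<And>y. Y \<le> y \<Longrightarrow> c * y powr (- a) \<le> hyp2F3_neg a \<nu> y"
      using hyp2F3_neg_lower_bound_pos[OF a0 \<nu>] by metis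
    obtain c' where c': "c' > 0" "\<forall>\<^sub>F y in at_top. c' \<le> y * hyp2F3_neg a \<nu> y"
      using hyp2F3_neg_lower_bound_gt_1_eventually[OF 4 \<nu>] by metis
    then obtain Z where Z: "\<And>y. Z \<le> y \<Longrightarrow> c' \<le> y * hyp2F3_neg a \<nu> y"
      by (auto simp: eventually_at_top_linorder)
    \<comment> \<open>From \<open>W\<close> on the bound of order \<open>1 / y\<close> applies.
      Between \<open>Y\<close> and \<open>W\<close> the weaker bound is still positive and smallest
      at \<open>W\<close>, because \<open>y powr (- a)\<close> decreases.\<close>
    define W where "W = max Y Z"
    have W: "W > 0" "Z \<le> W" "Y \<le> W" using Y by (auto simp: W_def)
    have "\<exists>c>0. \<forall>y\<ge>0. c * (1 + y) powr (-1) \<le> hyp2F3_neg a \<nu> y"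
    proof (rule lower_bound_glue[of W "min (1/2) (c * W powr (- a))" c'])
      show "min (1/2) (c * W powr (- a)) > 0" using Y W by simp
      fix y
      show "min (1/2) (c * W powr (- a)) \<le> hyp2F3_neg a \<nu> y" if y: "0 \<le> y" "y \<le> W"
      proof (cases "y \<le> Y")
        case True
        then show ?thesis using Y(3)[of y] y by simp
      next
        case False
        have "W powr (- a) \<le> y powr (- a)"
          using False Y(1) y a0 by (intro powr_mono2') auto
        then have "c * W powr (- a) \<le> c * y powr (- a)"
          using Y by (intro mult_left_mono) auto
        then show ?thesis using Y(4)[of y] False by simp
      qed
      show "c' * y powr (-1) \<le> hyp2F3_neg a \<nu> y" if "W \<le> y"
        using Z[of y] that W by (simp add: powr_minus field_simps)
    qed (use W c' in auto)
    then show ?thesis using 4 by (simp add: max_def)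
  qed
qed

section \<open>Fourier coefficients on the torus\<close>

lemma freq_eq_0_iff: "freq k = 0 \<longleftrightarrow> k = 0"
  by (simp add: freq_def vec_eq_iff)

lemma norm_freq_ge_1:
  assumes "k \<noteq> 0"
  shows "norm (freq k) \<ge> 1"
proof -
  obtain i where "k $ i \<noteq> 0" using assms by (auto simp: vec_eq_iff)
  then have "1 \<le> \<bar>freq k $ i\<bar>" by (simp add: freq_def)
  also have "\<dots> \<le> norm (freq k)" by (rule component_le_norm_cart)
  finally show ?thesis .
qed

lemma fmode_has_derivative:
  "((\<lambda>x. c * fmode k x) has_derivative (\<lambda>h. c * (\<i> * complex_of_real (freq k \<bullet> h) * fmode k x))) (at x)"
  unfolding fmode_def
  by (auto intro!: derivative_eq_intros simp: scaleR_conv_of_real algebra_simps)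

lemma pd_fmode:
  "pd i (\<lambda>x. c * fmode k x) = (\<lambda>x. (c * \<i> * complex_of_real (freq k $ i)) * fmode k x)"
  unfolding pd_def
  by (rule ext, subst frechet_derivative_at[OF fmode_has_derivative, symmetric])
    (simp add: inner_axis)

text \<open>Differentiation only changes the scalar in front of a mode; carrying that scalar makes
  the induction work and gives smoothness.\<close>

lemma fold_pd_fmode: "\<exists>d. fold pd is (\<lambda>x. c * fmode k x) = (\<lambda>x. d * fmode k x)"
  by (induction "is" arbitrary: c) (auto simp: pd_fmode)

lemma fmode_periodic: "fmode k (x + axis i (2 * pi)) = fmode k x"
proof -
  have "freq k \<bullet> (x + axis i (2 * pi)) = freq k \<bullet> x + 2 * pi * of_int (k $ i)"
    by (simp add: inner_add_right inner_axis freq_def)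
  then show ?thesis
    by (simp add: fmode_def flip: cis_mult)
qed

lemma test_function_fmode: "test_function (fmode k)"
  unfolding test_function_def
proof (intro conjI allI)
  fix "is" x
  obtain d where "fold pd is (\<lambda>x. 1 * fmode k x) = (\<lambda>x. d * fmode k x)"
    using fold_pd_fmode by blast
  then show "fold pd is (fmode k) differentiable at x"
    using fmode_has_derivative unfolding differentiable_def by fastforce
qed (rule fmode_periodic)

lemma fmode_mult: "fmode k x * fmode l x = fmode (k + l) x"
proof -
  have "freq (k + l) = freq k + freq l" by (simp add: freq_def vec_eq_iff)
  then show ?thesis by (simp add: fmode_def cis_mult inner_add_left)
qed

section \<open>Orthogonality of the Fourier modes\<close>

lemma integral_cis_period:
  assumes "m \<noteq> 0"
  shows "(LINT x:{0..2*pi}|lborel. cis (of_int m * x)) = 0"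
proof -
  let ?F = "\<lambda>x. cis (of_int m * x) / (\<i> * of_int m)"
  have int: "((\<lambda>x. cis (of_int m * x)) has_integral (?F (2 * pi) - ?F 0)) {0..2*pi}"
  proof (rule fundamental_theorem_of_calculus)
    fix x
    show "(?F has_vector_derivative cis (of_int m * x)) (at x within {0..2*pi})"
      unfolding has_vector_derivative_def using assms
      by (auto intro!: derivative_eq_intros simp: scaleR_conv_of_real field_simps)
  qed simp
  have "cis (of_int m * (2 * pi)) = 1"
    using cis_multiple_2pi[of "of_int m"] by (simp add: mult.commute mult.left_commute)
  then have "integral {0..2*pi} (\<lambda>x. cis (of_int m * x)) = 0"
    using integral_unique[OF int] by simp
  moreover have "set_integrable lborel {0..2*pi} (\<lambda>x. cis (of_int m * x))"
    by (intro borel_integrable_atLeastAtMost' continuous_intros)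
  ultimately show ?thesis
    by (simp add: set_borel_integral_eq_integral(2))
qed

lemma torus_indicator: "indicator torus (x :: real ^ 'n) = (\<Prod>i\<in>UNIV. indicator {0..2*pi} (x $ i) :: real)"
  by (auto simp: torus_def indicator_def mem_box_cart)

lemma cis_sum: "finite A \<Longrightarrow> cis (sum f A) = (\<Prod>i\<in>A. cis (f i))"
  by (induction A rule: finite_induct) (auto simp: cis_mult[symmetric])

text \<open>Fubini: on the torus a mode is a product of functions of one coordinate, and a
  coordinate with nonzero frequency contributes an integral over full periods, which is 0.\<close>

lemma integral_torus_fmode:
  "integral torus (fmode k :: real ^ 'n \<Rightarrow> complex) = (if k = 0 then of_real ((2 * pi) ^ CARD('n)) else 0)"
proof (cases "k = 0")
  case True
  have [simp]: "fmode 0 = (\<lambda>x :: real ^ 'n. 1)"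
    by (simp add: fmode_def freq_def fun_eq_iff inner_vec_def)
  have "integral torus (\<lambda>x :: real ^ 'n. 1 :: complex) = of_real (measure lborel (torus :: (real ^ 'n) set))"
    unfolding torus_def by (simp add: scaleR_conv_of_real)
  also have "measure lborel (torus :: (real ^ 'n) set) = (2 * pi) ^ CARD('n)"
    unfolding torus_def by (subst content_cbox_cart) (auto simp: interval_ne_empty_cart)
  finally show ?thesis using True by simp
next
  case False
  then obtain j where j: "k $ j \<noteq> 0" by (auto simp: vec_eq_iff)
  \<comment> \<open>The indicator is part of each one-dimensional factor, so that the integral over
    the whole space factorizes.\<close>
  define g where "g b x = indicator {0..2*pi} x *\<^sub>R cis ((freq k \<bullet> b) * x)" for b :: "real ^ 'n" and x :: real
  have g: "integrable lborel (g b)" for b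
    unfolding g_def set_integrable_def[symmetric]
    by (intro borel_integrable_atLeastAtMost' continuous_intros)
  then have [measurable]: "g b \<in> borel_measurable borel" for b
    using borel_measurable_integrable[of lborel "g b"] by simp
  have split: "indicator torus x *\<^sub>R fmode k x = (\<Prod>b\<in>Basis. g b (x \<bullet> b))" for x
  proof -
    have "(\<Prod>b\<in>Basis. g b (x \<bullet> b)) = (\<Prod>i\<in>UNIV. g (axis i 1) (x \<bullet> axis i 1))"
      unfolding Basis_vec_def
      by (subst prod.reindex[of "\<lambda>i. axis i 1", symmetric, unfolded comp_def])
        (auto simp: inj_on_def axis_eq_axis intro!: prod.cong)
    also have "\<dots> = (\<Prod>i\<in>UNIV. of_real (indicator {0..2*pi} (x $ i)) * cis (freq k $ i * x $ i))"
      by (simp add: g_def inner_axis scaleR_conv_of_real)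
    also have "\<dots> = indicator torus x *\<^sub>R fmode k x"
      by (simp add: prod.distrib torus_indicator fmode_def inner_vec_def cis_sum scaleR_conv_of_real)
    finally show ?thesis by simp
  qed
  interpret product_sigma_finite "\<lambda>_ :: real ^ 'n. lborel :: real measure"
    by unfold_locales
  have "(LINT x:torus|lborel. fmode k x) = (\<integral>x. (\<Prod>b\<in>Basis. g b (x \<bullet> b)) \<partial>lborel)"
    by (simp add: set_lebesgue_integral_def split)
  \<comment> \<open>Lebesgue measure on the vector space is the image of the product measure under
    \<open>f \<mapsto> (\<Sum>c\<in>Basis. f c *\<^sub>R c)\<close>.\<close>
  also have "\<dots> = (\<integral>f. (\<Prod>b\<in>Basis. g b ((\<Sum>c\<in>Basis. f c *\<^sub>R c) \<bullet> b)) \<partial>(\<Pi>\<^sub>M b\<in>(Basis :: (real ^ 'n) set). lborel))"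
    unfolding lborel_eq[where 'a = "real ^ 'n"] by (rule integral_distr) measurable
  also have "\<dots> = (\<integral>f. (\<Prod>b\<in>Basis. g b (f b)) \<partial>(\<Pi>\<^sub>M b\<in>(Basis :: (real ^ 'n) set). lborel))"
    by (intro Bochner_Integration.integral_cong prod.cong refl) simp
  also have "\<dots> = (\<Prod>b\<in>Basis. integral\<^sup>L lborel (g b))"
    by (intro product_integral_prod g) simp
  also have "integral\<^sup>L lborel (g (axis j 1)) = 0"
    using integral_cis_period[OF j] by (simp add: g_def[abs_def] set_lebesgue_integral_def inner_axis freq_def)
  then have "(\<Prod>b\<in>Basis. integral\<^sup>L lborel (g b)) = 0"
    by (intro prod_zero) (auto simp: Basis_vec_def)
  finally have "(LINT x:torus|lborel. fmode k x) = 0" .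
  moreover have "set_integrable lborel torus (fmode k :: real ^ 'n \<Rightarrow> complex)"
    unfolding torus_def fmode_def cis_conv_exp
    by (intro borel_integrable_compact[unfolded set_integrable_def[symmetric]] continuous_intros) auto
  ultimately show ?thesis
    using False set_borel_integral_eq_integral(2)[of torus "fmode k"] by simp
qed

text \<open>Orthogonality kills all terms except \<open>l = k\<close>, so the infinite sum is a
  single term whatever the growth of \<open>c\<close>.\<close>

lemma fourier_series_fmode:
  fixes c :: "int ^ 'n \<Rightarrow> complex"
  shows "fourier_series c (fmode (- k)) = c k * of_real ((2 * pi) ^ CARD('n))"
proof -
  have "fourier_series c (fmode (- k)) = (\<Sum>\<^sub>\<infinity>l\<in>{k}. c l * integral torus (\<lambda>x. fmode l x * fmode (- k) x))"
    unfolding fourier_series_def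
    by (rule infsum_cong_neutral) (auto simp: fmode_mult integral_torus_fmode)
  then show ?thesis by (simp add: fmode_mult integral_torus_fmode)
qed

lemma fourier_coeff_dist_eq_fourier_series:
  assumes "dist_eq T (fourier_series c)"
  shows "fourier_coeff T k = c k"
  using assms test_function_fmode[of "- k"]
  by (simp add: dist_eq_def fourier_coeff_def fourier_series_fmode)

text \<open>Dominated convergence for counting measure: a finite set carries all but
  \<open>e / 2\<close> of the sum of \<open>g\<close>, and on that set the limit may be taken
  termwise.\<close>

lemma infsum_tendsto_0_dominated:
  fixes f :: "'a \<Rightarrow> 'b \<Rightarrow> real"
  assumes g: "g summable_on A"
    and bound: "\<forall>\<^sub>F a in F. \<forall>k\<in>A. \<bar>f a k\<bar> \<le> g k"
    and lim: "\<And>k. k \<in> A \<Longrightarrow> ((\<lambda>a. f a k) \<longlongrightarrow> 0) F"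
  shows "((\<lambda>a. \<Sum>\<^sub>\<infinity>k\<in>A. f a k) \<longlongrightarrow> 0) F"
proof (rule tendstoI)
  fix e :: real assume e: "e > 0"
  have "\<forall>\<^sub>F S in finite_subsets_at_top A. dist (sum g S) (infsum g A) < e / 2"
    using infsum_tendsto[OF g] e by (intro tendstoD) auto
  then obtain S where S: "finite S" "S \<subseteq> A" "dist (sum g S) (infsum g A) < e / 2"
    by (auto simp: eventually_finite_subsets_at_top)
  have gS: "g summable_on (A - S)"
    by (rule summable_on_subset_banach[OF g]) auto
  have "infsum g A = sum g S + infsum g (A - S)"
    using infsum_Un_disjoint[of g S "A - S"] gS S by (simp add: Un_absorb1)
  then have tail: "infsum g (A - S) < e / 2"
    using S(3) by (simp add: dist_real_def)
  have "((\<lambda>a. \<Sum>k\<in>S. f a k) \<longlongrightarrow> (\<Sum>k\<in>S. 0)) F"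
    using S by (intro tendsto_sum lim) auto
  then have "\<forall>\<^sub>F a in F. dist (\<Sum>k\<in>S. f a k) 0 < e / 2"
    using e by (intro tendstoD) auto
  with bound show "\<forall>\<^sub>F a in F. dist (\<Sum>\<^sub>\<infinity>k\<in>A. f a k) 0 < e"
  proof eventually_elim
    case (elim a)
    have n: "(\<lambda>k. norm (f a k)) summable_on (A - S)"
      by (rule summable_on_comparison_test[OF gS]) (use elim in auto)
    then have f: "f a summable_on (A - S)"
      by (rule abs_summable_summable)
    have "\<bar>infsum (f a) (A - S)\<bar> \<le> infsum (\<lambda>k. norm (f a k)) (A - S)"
      using norm_infsum_bound[OF n] by simp
    also have "\<dots> \<le> infsum g (A - S)"
      by (rule infsum_mono[OF n gS]) (use elim in auto)
    finally have "\<bar>infsum (f a) (A - S)\<bar> < e / 2" using tail by simp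
    moreover have "infsum (f a) A = sum (f a) S + infsum (f a) (A - S)"
      using infsum_Un_disjoint[of "f a" S "A - S"] f S by (simp add: Un_absorb1)
    ultimately show ?case using elim by (simp add: dist_real_def)
  qed
qed

section \<open>Multiplier bounds and convergence\<close>

lemma multiplier_eq_hyp2F3_neg:
  fixes \<nu> :: "real ^ 'n"
  shows "multiplier \<delta> \<beta> \<nu> =
    - ((norm \<nu>)\<^sup>2 * hyp2F3_neg ((real CARD('n) + 2 - \<beta>) / 2) (real CARD('n) / 2) ((norm \<nu>)\<^sup>2 * \<delta>\<^sup>2 / 4))"
proof -
  have e: "(real CARD('n) + 4 - \<beta>) / 2 = (real CARD('n) + 2 - \<beta>) / 2 + 1" "(real CARD('n) + 2) / 2 = real CARD('n) / 2 + 1"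
    by (simp_all add: field_simps)
  show ?thesis
    unfolding multiplier_def hyp2F3_uminus[symmetric] e by simp
qed

lemma multiplier_tendsto:
  fixes \<nu> :: "real ^ 'n"
  assumes "\<beta> < real CARD('n) + 4"
  shows "((\<lambda>\<delta>. multiplier \<delta> \<beta> \<nu>) \<longlongrightarrow> - (norm \<nu>)\<^sup>2) (at_right 0)"
proof -
  let ?a = "(real CARD('n) + 2 - \<beta>) / 2"
  have cont: "isCont (hyp2F3_neg ?a (real CARD('n) / 2)) 0"
    using assms by (intro DERIV_isCont[OF hyp2F3_neg_deriv_0]) (auto simp: field_simps)
  have "((\<lambda>\<delta>. (norm \<nu>)\<^sup>2 * \<delta>\<^sup>2 / 4) \<longlongrightarrow> (norm \<nu>)\<^sup>2 * 0\<^sup>2 / 4) (at_right 0)"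
    by (intro tendsto_intros) auto
  then have "((\<lambda>\<delta>. - ((norm \<nu>)\<^sup>2 * hyp2F3_neg ?a (real CARD('n) / 2) ((norm \<nu>)\<^sup>2 * \<delta>\<^sup>2 / 4))) \<longlongrightarrow>
      - ((norm \<nu>)\<^sup>2 * hyp2F3_neg ?a (real CARD('n) / 2) 0)) (at_right 0)"
    by (intro tendsto_intros isCont_tendsto_compose[OF cont]) simp
  then show ?thesis by (simp add: multiplier_eq_hyp2F3_neg)
qed

text \<open>
  Half the order of growth of \<open>- m\<close> in \<open>\<bar>k\<bar>\<close> (up to a logarithm at \<open>\<beta> = n\<close>), as weights are
  powers of \<open>1 + \<bar>k\<bar>\<^sup>2\<close>.
\<close>

definition growth :: "real \<Rightarrow> real \<Rightarrow> real" where
  "growth n \<beta> = max 0 (\<beta> - n) / 2"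

text \<open>The hypothesis on \<open>\<beta>\<close> says \<open>a > -1\<close>, and
  \<open>n \<ge> 1\<close> says \<open>n / 2 \<ge> 1/2\<close>. The constant is uniform in
  \<open>\<delta>\<close> and the frequency; the weight still containing \<open>\<delta>\<close> is
  simplified below in two ways.\<close>

lemma multiplier_lower_bound:
  assumes "\<beta> < real CARD('n::finite) + 4"
  obtains c where "c > 0" "\<And>\<delta> (\<nu> :: real ^ 'n).
    c * ((norm \<nu>)\<^sup>2 * (1 + (norm \<nu>)\<^sup>2 * \<delta>\<^sup>2 / 4) powr (growth (real CARD('n)) \<beta> - 1)) \<le> - multiplier \<delta> \<beta> \<nu>"
proof -
  let ?a = "(real CARD('n) + 2 - \<beta>) / 2"
  have growth: "max (-1) (- ?a) = growth (real CARD('n)) \<beta> - 1"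
    by (auto simp: growth_def max_def field_simps)
  have "\<exists>c>0. \<forall>y\<ge>0. c * (1 + y) powr max (-1) (- ?a) \<le> hyp2F3_neg ?a (real CARD('n) / 2) y"
    using assms by (intro hyp2F3_neg_lower_bound) (auto simp: field_simps Suc_leI)
  then obtain c where c: "c > 0"
    "\<And>y. y \<ge> 0 \<Longrightarrow> c * (1 + y) powr (growth (real CARD('n)) \<beta> - 1) \<le> hyp2F3_neg ?a (real CARD('n) / 2) y"
    unfolding growth by blast
  show ?thesis
  proof (rule that[OF c(1)])
    fix \<delta> and \<nu> :: "real ^ 'n"
    have "(norm \<nu>)\<^sup>2 * (c * (1 + (norm \<nu>)\<^sup>2 * \<delta>\<^sup>2 / 4) powr (growth (real CARD('n)) \<beta> - 1)) \<le>
        (norm \<nu>)\<^sup>2 * hyp2F3_neg ?a (real CARD('n) / 2) ((norm \<nu>)\<^sup>2 * \<delta>\<^sup>2 / 4)"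
      by (intro mult_left_mono c) auto
    then show "c * ((norm \<nu>)\<^sup>2 * (1 + (norm \<nu>)\<^sup>2 * \<delta>\<^sup>2 / 4) powr (growth (real CARD('n)) \<beta> - 1)) \<le>
        - multiplier \<delta> \<beta> \<nu>"
      by (simp add: multiplier_eq_hyp2F3_neg mult_ac)
  qed
qed

lemma half_weight_le:
  fixes x r :: real
  assumes "x \<ge> 1"
  shows "(1 + x) powr r / 2 \<le> x * (1 + x) powr (r - 1)"
proof -
  have "(1 + x) powr r = (1 + x) * (1 + x) powr (r - 1)"
    using assms by (simp add: powr_diff)
  also have "\<dots> \<le> (2 * x) * (1 + x) powr (r - 1)"
    using assms by (intro mult_right_mono) auto
  finally show ?thesis by simp
qed

text \<open>The minimum covers both signs of the exponent: the lower comparison is used for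
  \<open>e \<ge> 0\<close>, the upper one for \<open>e < 0\<close>.\<close>

lemma powr_comparable_lower:
  fixes w z :: real
  assumes "0 < l" "0 < u" "0 < z" "l * z \<le> w" "w \<le> u * z"
  shows "min (l powr e) (u powr e) * z powr e \<le> w powr e"
proof (cases "e \<ge> 0")
  case True
  have "min (l powr e) (u powr e) * z powr e \<le> l powr e * z powr e"
    by (intro mult_right_mono) auto
  also have "\<dots> = (l * z) powr e" by (rule powr_mult[symmetric])
  also have "\<dots> \<le> w powr e" using assms True by (intro powr_mono2) auto
  finally show ?thesis .
next
  case False
  have w: "0 < w" using assms by (meson less_le_trans mult_pos_pos)
  have "min (l powr e) (u powr e) * z powr e \<le> u powr e * z powr e"
    by (intro mult_right_mono) auto
  also have "\<dots> = (u * z) powr e" by (rule powr_mult[symmetric])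
  also have "\<dots> \<le> w powr e" using assms w False by (intro powr_mono2') auto
  finally show ?thesis .
qed

text \<open>For one fixed \<open>\<delta>\<close> the quantities
  \<open>1 + x * \<delta>^2 / 4\<close> and \<open>1 + x\<close> are comparable, which gives the
  full order of growth with a constant depending on \<open>\<delta>\<close>. This decides membership
  of the solution in its Sobolev space.\<close>

lemma multiplier_bound_fixed:
  assumes "\<beta> < real CARD('n::finite) + 4" and \<delta>: "\<delta> > 0"
  obtains c where "c > 0" "\<And>k :: int ^ 'n. k \<noteq> 0 \<Longrightarrow>
    c * (1 + (norm (freq k))\<^sup>2) powr growth (real CARD('n)) \<beta> \<le> - multiplier \<delta> \<beta> (freq k)"
proof -
  let ?r = "growth (real CARD('n)) \<beta>"
  obtain c where c: "c > 0" "\<And>\<nu> :: real ^ 'n.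
    c * ((norm \<nu>)\<^sup>2 * (1 + (norm \<nu>)\<^sup>2 * \<delta>\<^sup>2 / 4) powr (?r - 1)) \<le> - multiplier \<delta> \<beta> \<nu>"
    using multiplier_lower_bound[OF assms(1)] by metis
  define l u where "l = min 1 (\<delta>\<^sup>2 / 4)" and "u = max 1 (\<delta>\<^sup>2 / 4)"
  define L where "L = min (l powr (?r - 1)) (u powr (?r - 1))"
  have lu: "l > 0" "u > 0" using \<delta> by (auto simp: l_def u_def)
  have L: "L > 0" using lu by (auto simp: L_def)
  show ?thesis
  proof (rule that)
    show "c * L / 2 > 0" using c L by simp
    fix k :: "int ^ 'n" assume k: "k \<noteq> 0"
    define x where "x = (norm (freq k))\<^sup>2"
    have x: "x \<ge> 1" using norm_freq_ge_1[OF k] by (simp add: x_def)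
    have "L * (1 + x) powr (?r - 1) \<le> (1 + x * \<delta>\<^sup>2 / 4) powr (?r - 1)"
      unfolding L_def
    proof (rule powr_comparable_lower[OF lu])
      have "x * l \<le> x * (\<delta>\<^sup>2 / 4)" "x * (\<delta>\<^sup>2 / 4) \<le> x * u"
        using x by (intro mult_left_mono; simp add: l_def u_def)+
      moreover have "l \<le> 1" "1 \<le> u" by (auto simp: l_def u_def)
      ultimately show "l * (1 + x) \<le> 1 + x * \<delta>\<^sup>2 / 4" "1 + x * \<delta>\<^sup>2 / 4 \<le> u * (1 + x)"
        by (simp_all add: algebra_simps)
    qed (use x in auto)
    then have "x * (L * (1 + x) powr (?r - 1)) \<le> x * (1 + x * \<delta>\<^sup>2 / 4) powr (?r - 1)"
      using x by (intro mult_left_mono) auto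
    moreover have "L * ((1 + x) powr ?r / 2) \<le> L * (x * (1 + x) powr (?r - 1))"
      using L by (intro mult_left_mono half_weight_le x) auto
    ultimately have "L * ((1 + x) powr ?r / 2) \<le> x * (1 + x * \<delta>\<^sup>2 / 4) powr (?r - 1)"
      by (simp add: mult_ac)
    then have "c * (L * ((1 + x) powr ?r / 2)) \<le> c * (x * (1 + x * \<delta>\<^sup>2 / 4) powr (?r - 1))"
      using c by (intro mult_left_mono) auto
    also have "\<dots> \<le> - multiplier \<delta> \<beta> (freq k)"
      unfolding x_def by (rule c)
    finally show "c * L / 2 * (1 + (norm (freq k))\<^sup>2) powr ?r \<le> - multiplier \<delta> \<beta> (freq k)"
      by (simp add: x_def mult_ac)
  qed
qed

text \<open>The limit needs a constant independent of \<open>\<delta>\<close>. If the growth is at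
  least 1, the weight with \<open>\<delta>\<close> is at least 1 and is dropped, leaving order 1;
  otherwise its exponent is negative and \<open>\<delta> < 2\<close> allows replacing
  \<open>\<delta>^2 / 4\<close> by 1.\<close>

lemma multiplier_bound_uniform:
  assumes "\<beta> < real CARD('n::finite) + 4"
  obtains c where "c > 0" "\<And>\<delta> (k :: int ^ 'n). 0 < \<delta> \<Longrightarrow> \<delta> < 2 \<Longrightarrow> k \<noteq> 0 \<Longrightarrow>
    c * (1 + (norm (freq k))\<^sup>2) powr min 1 (growth (real CARD('n)) \<beta>) \<le> - multiplier \<delta> \<beta> (freq k)"
proof -
  let ?r = "growth (real CARD('n)) \<beta>"
  obtain c where c: "c > 0" "\<And>\<delta> (\<nu> :: real ^ 'n).
    c * ((norm \<nu>)\<^sup>2 * (1 + (norm \<nu>)\<^sup>2 * \<delta>\<^sup>2 / 4) powr (?r - 1)) \<le> - multiplier \<delta> \<beta> \<nu>"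
    using multiplier_lower_bound[OF assms(1)] by metis
  show ?thesis
  proof (rule that)
    show "c / 2 > 0" using c by simp
    fix \<delta> :: real and k :: "int ^ 'n" assume \<delta>: "0 < \<delta>" "\<delta> < 2" and k: "k \<noteq> 0"
    define x where "x = (norm (freq k))\<^sup>2"
    have x: "x \<ge> 1" using norm_freq_ge_1[OF k] by (simp add: x_def)
    have "(1 + x) powr (min 1 ?r - 1) \<le> (1 + x * \<delta>\<^sup>2 / 4) powr (?r - 1)"
    proof (cases "?r \<ge> 1")
      case True
      have "1 \<le> (1 + x * \<delta>\<^sup>2 / 4) powr (?r - 1)"
        using True x by (intro ge_one_powr_ge_zero) auto
      then show ?thesis using True by simp
    next
      case False
      have "\<delta>\<^sup>2 \<le> 2\<^sup>2" using \<delta> by (intro power_mono) auto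
      then have "x * \<delta>\<^sup>2 \<le> x * 4" using x by (intro mult_left_mono) auto
      moreover have "0 < 1 + x * \<delta>\<^sup>2 / 4" using x by (intro add_pos_nonneg) auto
      ultimately have "(1 + x) powr (?r - 1) \<le> (1 + x * \<delta>\<^sup>2 / 4) powr (?r - 1)"
        using False by (intro powr_mono2') auto
      then show ?thesis using False by simp
    qed
    then have "x * (1 + x) powr (min 1 ?r - 1) \<le> x * (1 + x * \<delta>\<^sup>2 / 4) powr (?r - 1)"
      using x by (intro mult_left_mono) auto
    then have "(1 + x) powr min 1 ?r / 2 \<le> x * (1 + x * \<delta>\<^sup>2 / 4) powr (?r - 1)"
      using half_weight_le[OF x, of "min 1 ?r"] by linarith
    then have "c * ((1 + x) powr min 1 ?r / 2) \<le> c * (x * (1 + x * \<delta>\<^sup>2 / 4) powr (?r - 1))"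
      using c by (intro mult_left_mono) auto
    also have "\<dots> \<le> - multiplier \<delta> \<beta> (freq k)"
      unfolding x_def by (rule c)
    finally show "c / 2 * (1 + (norm (freq k))\<^sup>2) powr min 1 ?r \<le> - multiplier \<delta> \<beta> (freq k)"
      by (simp add: x_def mult_ac)
  qed
qed

section \<open>Wave factors and Sobolev estimates\<close>

text \<open>The function \<open>m\<close> is a parameter so that the nonlocal and the local solution
  are both instances. The value at \<open>k = 0\<close> is the limit of the other expression as
  \<open>m k\<close> tends to 0 from below.\<close>

definition wave_factor :: "real \<Rightarrow> (int ^ 'n \<Rightarrow> real) \<Rightarrow> int ^ 'n \<Rightarrow> real" where
  "wave_factor t m k = (if k = 0 then t\<^sup>2 / 2 else (cos (sqrt (- m k) * t) - 1) / m k)"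

lemma nonlocal_wave_eq:
  "nonlocal_wave \<delta> \<beta> b t = fourier_series (\<lambda>k. fourier_coeff b k *
     of_real (wave_factor t (\<lambda>k. multiplier \<delta> \<beta> (freq k)) k))"
  unfolding nonlocal_wave_def wave_factor_def
  by (intro arg_cong[where f = fourier_series] ext) auto

lemma local_wave_eq:
  "local_wave b t = fourier_series (\<lambda>k. fourier_coeff b k *
     of_real (wave_factor t (\<lambda>k. - (norm (freq k))\<^sup>2) k))"
  unfolding local_wave_def wave_factor_def
  by (intro arg_cong[where f = fourier_series] ext) auto

text \<open>The numerator is at most 2 in absolute value. At \<open>k = 0\<close> the weight equals
  1, and the maximum accounts for \<open>t^2 / 2\<close>.\<close>

lemma wave_factor_bound:
  assumes c: "c > 0" and m: "\<And>k. k \<noteq> 0 \<Longrightarrow> c * (1 + (norm (freq k))\<^sup>2) powr r \<le> - m k"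
  shows "\<bar>wave_factor t m k\<bar> \<le> max (t\<^sup>2 / 2) (2 / c) * (1 + (norm (freq k))\<^sup>2) powr (- r)"
proof (cases "k = 0")
  case True
  then have "norm (freq k) = 0" by (simp add: freq_eq_0_iff)
  then show ?thesis using True by (simp add: wave_factor_def)
next
  case False
  define z where "z = 1 + (norm (freq k))\<^sup>2"
  have z: "z > 0" by (simp add: z_def add_pos_nonneg)
  have pos: "c * z powr r > 0" using c z by simp
  have "\<bar>cos (sqrt (- m k) * t) - 1\<bar> \<le> 2"
    using cos_le_one[of "sqrt (- m k) * t"] cos_ge_minus_one[of "sqrt (- m k) * t"] by linarith
  moreover have "c * z powr r \<le> \<bar>m k\<bar>"
    using m[OF False] by (simp add: z_def)
  ultimately have "\<bar>wave_factor t m k\<bar> \<le> 2 / (c * z powr r)"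
    unfolding wave_factor_def if_not_P[OF False] abs_divide using pos by (intro frac_le) auto
  also have "\<dots> = 2 / c * z powr (- r)"
    by (simp add: powr_minus divide_inverse)
  also have "\<dots> \<le> max (t\<^sup>2 / 2) (2 / c) * z powr (- r)"
    by (intro mult_right_mono) auto
  finally show ?thesis by (simp add: z_def)
qed

lemma weighted_square_bound:
  fixes z A K \<sigma> r :: real and b :: complex
  assumes z: "z > 0" and A: "\<bar>A\<bar> \<le> K * z powr (- r)"
  shows "z powr (\<sigma> + 2 * r) * (cmod (b * of_real A))\<^sup>2 \<le> K\<^sup>2 * (z powr \<sigma> * (cmod b)\<^sup>2)"
proof -
  have e: "z powr (\<sigma> + 2 * r) * (z powr (- r))\<^sup>2 = z powr \<sigma>"
    using z by (simp add: power2_eq_square flip: powr_add)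
  have "A\<^sup>2 \<le> (K * z powr (- r))\<^sup>2"
    using A by (simp add: abs_le_square_iff[symmetric])
  then have "z powr (\<sigma> + 2 * r) * (cmod b)\<^sup>2 * A\<^sup>2 \<le> z powr (\<sigma> + 2 * r) * (cmod b)\<^sup>2 * (K * z powr (- r))\<^sup>2"
    by (intro mult_left_mono) auto
  also have "\<dots> = K\<^sup>2 * ((z powr (\<sigma> + 2 * r) * (z powr (- r))\<^sup>2) * (cmod b)\<^sup>2)"
    by (simp add: power_mult_distrib)
  finally show ?thesis
    unfolding e by (simp add: norm_mult power_mult_distrib mult_ac)
qed

text \<open>Factors of order \<open>- r\<close> in \<open>1 + \<bar>k\<bar>^2\<close> raise the
  Sobolev order by \<open>2 * r\<close>, since the norm squares the coefficients.\<close>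

lemma sobolev_space_multiplierI:
  fixes b T :: "'n::finite functional"
  assumes b: "b \<in> sobolev_space \<sigma>" and T: "periodic_distribution T"
    and coeff: "\<And>k. fourier_coeff T k = fourier_coeff b k * of_real (A k)"
    and A: "\<And>k. \<bar>A k\<bar> \<le> K * (1 + (norm (freq k))\<^sup>2) powr (- r)"
  shows "T \<in> sobolev_space (\<sigma> + 2 * r)"
proof -
  let ?g = "\<lambda>k. K\<^sup>2 * ((1 + (norm (freq k))\<^sup>2) powr \<sigma> * (cmod (fourier_coeff b k))\<^sup>2)"
  have "?g summable_on UNIV"
    using b by (intro summable_on_cmult_right) (simp add: sobolev_space_def)
  then have "(\<lambda>k. (1 + (norm (freq k))\<^sup>2) powr (\<sigma> + 2 * r) * (cmod (fourier_coeff T k))\<^sup>2) summable_on UNIV"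
  proof (rule summable_on_comparison_test)
    fix k
    show "(1 + (norm (freq k))\<^sup>2) powr (\<sigma> + 2 * r) * (cmod (fourier_coeff T k))\<^sup>2 \<le> ?g k"
      unfolding coeff by (rule weighted_square_bound[OF _ A]) (simp add: add_pos_nonneg)
  qed simp
  then show ?thesis using T by (simp add: sobolev_space_def)
qed

lemma sobolev_tendsto_multiplierI:
  fixes b T0 :: "'n::finite functional" and T :: "'a \<Rightarrow> 'n functional"
  assumes b: "b \<in> sobolev_space \<sigma>" and F: "F \<noteq> bot"
    and T: "\<forall>\<^sub>F a in F. periodic_distribution (T a) \<and>
      (\<forall>k. fourier_coeff (T a) k = fourier_coeff b k * of_real (A a k) \<and>
        \<bar>A a k\<bar> \<le> K * (1 + (norm (freq k))\<^sup>2) powr (- r))"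
    and T0: "periodic_distribution T0"
    and coeff0: "\<And>k. fourier_coeff T0 k = fourier_coeff b k * of_real (A0 k)"
    and lim: "\<And>k. ((\<lambda>a. A a k) \<longlongrightarrow> A0 k) F"
  shows "sobolev_tendsto (\<sigma> + 2 * r) T T0 F"
proof -
  define w where "w k = 1 + (norm (freq k))\<^sup>2" for k :: "int ^ 'n"
  have w: "w k > 0" for k by (simp add: w_def add_pos_nonneg)
  have T: "\<forall>\<^sub>F a in F. periodic_distribution (T a) \<and>
      (\<forall>k. fourier_coeff (T a) k = fourier_coeff b k * of_real (A a k) \<and> \<bar>A a k\<bar> \<le> K * w k powr (- r))"
    using T by (simp add: w_def)
  \<comment> \<open>The limit factors inherit the bound, as \<open>F\<close> is not trivial. Hence
    differences are bounded with \<open>2 * K\<close>, and the weighted series of \<open>b\<close>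
    dominates.\<close>
  have A0: "\<bar>A0 k\<bar> \<le> K * w k powr (- r)" for k
  proof (rule tendsto_upperbound[OF tendsto_rabs[OF lim] _ F])
    show "\<forall>\<^sub>F a in F. \<bar>A a k\<bar> \<le> K * w k powr (- r)"
      using T by eventually_elim auto
  qed
  define f where "f a k = w k powr (\<sigma> + 2 * r) * (cmod (fourier_coeff b k * of_real (A a k - A0 k)))\<^sup>2" for a k
  have "((\<lambda>a. \<Sum>\<^sub>\<infinity>k. f a k) \<longlongrightarrow> 0) F"
  proof (rule infsum_tendsto_0_dominated)
    show "(\<lambda>k. (2 * K)\<^sup>2 * (w k powr \<sigma> * (cmod (fourier_coeff b k))\<^sup>2)) summable_on UNIV"
      using b by (intro summable_on_cmult_right) (simp add: sobolev_space_def w_def)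
    show "\<forall>\<^sub>F a in F. \<forall>k\<in>UNIV. \<bar>f a k\<bar> \<le> (2 * K)\<^sup>2 * (w k powr \<sigma> * (cmod (fourier_coeff b k))\<^sup>2)"
      using T
    proof eventually_elim
      case (elim a)
      have diff: "\<bar>A a k - A0 k\<bar> \<le> 2 * K * w k powr (- r)" for k
      proof -
        have "\<bar>A a k\<bar> \<le> K * w k powr (- r)" using elim by blast
        then show ?thesis
          using abs_triangle_ineq4[of "A a k" "A0 k"] A0[of k] by linarith
      qed
      have "0 \<le> f a k" for k by (simp add: f_def)
      then show ?case
        using weighted_square_bound[OF w diff] by (simp only: f_def abs_of_nonneg simp_thms ball_UNIV)
    qed
    fix k
    have "((\<lambda>a. w k powr (\<sigma> + 2 * r) * (cmod (fourier_coeff b k * of_real (A a k - A0 k)))\<^sup>2) \<longlongrightarrow>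
        w k powr (\<sigma> + 2 * r) * (cmod (fourier_coeff b k * of_real (A0 k - A0 k)))\<^sup>2) F"
      by (intro tendsto_intros lim)
    then show "((\<lambda>a. f a k) \<longlongrightarrow> 0) F" by (simp add: f_def)
  qed
  then have "((\<lambda>a. sqrt (\<Sum>\<^sub>\<infinity>k. f a k)) \<longlongrightarrow> 0) F"
    using tendsto_real_sqrt by fastforce
  moreover have "\<forall>\<^sub>F a in F. sqrt (\<Sum>\<^sub>\<infinity>k. f a k) = sobolev_norm (\<sigma> + 2 * r) (\<lambda>\<phi>. T a \<phi> - T0 \<phi>)"
    using T
  proof eventually_elim
    case (elim a)
    have "fourier_coeff (\<lambda>\<phi>. T a \<phi> - T0 \<phi>) k = fourier_coeff (T a) k - fourier_coeff T0 k" for k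
      by (simp add: fourier_coeff_def diff_divide_distrib)
    then have "fourier_coeff (\<lambda>\<phi>. T a \<phi> - T0 \<phi>) k = fourier_coeff b k * of_real (A a k - A0 k)" for k
      using elim by (simp add: coeff0 algebra_simps)
    then show ?case
      by (simp only: sobolev_norm_def f_def w_def)
  qed
  ultimately have "((\<lambda>a. sobolev_norm (\<sigma> + 2 * r) (\<lambda>\<phi>. T a \<phi> - T0 \<phi>)) \<longlongrightarrow> 0) F"
    by (rule Lim_transform_eventually)
  moreover have "T0 \<in> sobolev_space (\<sigma> + 2 * r)"
    by (rule sobolev_space_multiplierI[OF b T0 coeff0 A0[unfolded w_def]])
  moreover have "\<forall>\<^sub>F a in F. T a \<in> sobolev_space (\<sigma> + 2 * r)"
    using T
  proof eventually_elim
    case (elim a)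
    then show ?case
      using sobolev_space_multiplierI[OF b, of "T a" "A a" K r] by (simp add: w_def)
  qed
  ultimately show ?thesis by (simp add: sobolev_tendsto_def)
qed

lemma wave_factor_tendsto:
  assumes "\<And>k. k \<noteq> 0 \<Longrightarrow> ((\<lambda>a. m a k) \<longlongrightarrow> m0 k) F" "\<And>k. k \<noteq> 0 \<Longrightarrow> m0 k \<noteq> 0"
  shows "((\<lambda>a. wave_factor t (m a) k) \<longlongrightarrow> wave_factor t m0 k) F"
proof (cases "k = 0")
  case False
  then show ?thesis
    unfolding wave_factor_def if_not_P[OF False]
    by (intro tendsto_divide tendsto_diff isCont_tendsto_compose[OF isCont_cos] tendsto_mult tendsto_real_sqrt tendsto_minus
        tendsto_const assms)
qed (simp add: wave_factor_def)

theorem theorem18: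
  fixes \<beta> \<sigma> t :: real
    and b :: "'n::finite functional"
    and U :: "real \<Rightarrow> real \<Rightarrow> 'n functional"
    and U0 :: "real \<Rightarrow> 'n functional"
  assumes "\<beta> < real CARD('n) + 4"
    and "b \<in> sobolev_space \<sigma>"
    and "\<And>\<delta>. \<delta> > 0 \<Longrightarrow> wave_solution (nonlocal_laplacian \<delta> \<beta>) b (U \<delta>)"
    and "\<And>\<delta> \<tau>. \<delta> > 0 \<Longrightarrow> \<tau> \<ge> 0 \<Longrightarrow> dist_eq (U \<delta> \<tau>) (nonlocal_wave \<delta> \<beta> b \<tau>)"
    and "wave_solution laplacian b U0"
    and "\<And>\<tau>. \<tau> \<ge> 0 \<Longrightarrow> dist_eq (U0 \<tau>) (local_wave b \<tau>)"
    and "t \<ge> 0"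
  defines "s \<equiv> \<sigma> + max 0 (\<beta> - real CARD('n))"
    and "s' \<equiv> \<sigma> + 2"
  shows "(\<forall>\<delta>>0. U \<delta> t \<in> sobolev_space s) \<and> U0 t \<in> sobolev_space s' \<and>
    (\<beta> \<le> real CARD('n) + 2 \<longrightarrow> sobolev_tendsto s (\<lambda>\<delta>. U \<delta> t) (U0 t) (at_right 0)) \<and>
    (real CARD('n) + 2 < \<beta> \<longrightarrow> sobolev_tendsto s' (\<lambda>\<delta>. U \<delta> t) (U0 t) (at_right 0))"
proof -
  let ?r = "growth (real CARD('n)) \<beta>"
  let ?m = "\<lambda>\<delta> (k :: int ^ 'n). multiplier \<delta> \<beta> (freq k)"
  let ?lap = "\<lambda>k :: int ^ 'n. - (norm (freq k))\<^sup>2"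
  have s: "s = \<sigma> + 2 * ?r" by (simp add: s_def growth_def)
  \<comment> \<open>The wave equations supply that the solutions are distributions, the series
    supply their Fourier coefficients; a Sobolev space asks for both.\<close>
  have dist: "periodic_distribution (U \<delta> t)" if "\<delta> > 0" for \<delta>
    using assms(3)[OF that] assms(7) by (auto simp: wave_solution_def)
  have dist0: "periodic_distribution (U0 t)"
    using assms(5,7) by (auto simp: wave_solution_def)
  have coeff: "fourier_coeff (U \<delta> t) k = fourier_coeff b k * of_real (wave_factor t (?m \<delta>) k)"
    if "\<delta> > 0" for \<delta> k
    using assms(4)[OF that assms(7)] unfolding nonlocal_wave_eq
    by (rule fourier_coeff_dist_eq_fourier_series)
  have coeff0: "fourier_coeff (U0 t) k = fourier_coeff b k * of_real (wave_factor t ?lap k)" for k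
    using assms(6)[OF assms(7)] unfolding local_wave_eq
    by (rule fourier_coeff_dist_eq_fourier_series)
  have "U \<delta> t \<in> sobolev_space s" if \<delta>: "\<delta> > 0" for \<delta>
  proof -
    obtain c where "c > 0" "\<And>k :: int ^ 'n. k \<noteq> 0 \<Longrightarrow> c * (1 + (norm (freq k))\<^sup>2) powr ?r \<le> - ?m \<delta> k"
      using multiplier_bound_fixed[OF assms(1) \<delta>] by metis
    from wave_factor_bound[OF this] show ?thesis
      unfolding s by (rule sobolev_space_multiplierI[OF assms(2) dist[OF \<delta>] coeff[OF \<delta>]])
  qed
  moreover have "U0 t \<in> sobolev_space s'"
  proof -
    \<comment> \<open>From \<open>\<bar>k\<bar> \<ge> 1\<close> follows
      \<open>1 + \<bar>k\<bar>^2 \<le> 2 * \<bar>k\<bar>^2\<close>, the bound of order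
      \<open>r = 1\<close>.\<close>
    have "1/2 * (1 + (norm (freq k))\<^sup>2) powr 1 \<le> - ?lap k" if "k \<noteq> 0" for k :: "int ^ 'n"
      using norm_freq_ge_1[OF that] by (simp add: add_pos_nonneg)
    from wave_factor_bound[OF _ this] have "U0 t \<in> sobolev_space (\<sigma> + 2 * 1)"
      by (rule sobolev_space_multiplierI[OF assms(2) dist0 coeff0]) simp
    then show ?thesis by (simp add: s'_def)
  qed
  \<comment> \<open>Both limits are this one: the order is \<open>s\<close> as long as
    \<open>?r \<le> 1\<close>, that is \<open>\<beta> \<le> n + 2\<close>, and \<open>s'\<close>
    beyond.\<close>
  moreover have "sobolev_tendsto (\<sigma> + 2 * min 1 ?r) (\<lambda>\<delta>. U \<delta> t) (U0 t) (at_right 0)"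
  proof -
    obtain c where c: "c > 0" "\<And>\<delta> (k :: int ^ 'n). 0 < \<delta> \<Longrightarrow> \<delta> < 2 \<Longrightarrow> k \<noteq> 0 \<Longrightarrow>
        c * (1 + (norm (freq k))\<^sup>2) powr min 1 ?r \<le> - ?m \<delta> k"
      using multiplier_bound_uniform[OF assms(1)] by metis
    show ?thesis
    proof (rule sobolev_tendsto_multiplierI[OF assms(2) _ _ dist0 coeff0])
      have "\<forall>\<^sub>F \<delta>::real in at_right 0. 0 < \<delta> \<and> \<delta> < 2"
        by (auto simp: eventually_at_right_field intro!: exI[of _ 2])
      then show "\<forall>\<^sub>F \<delta> in at_right 0. periodic_distribution (U \<delta> t) \<and>
          (\<forall>k. fourier_coeff (U \<delta> t) k = fourier_coeff b k * of_real (wave_factor t (?m \<delta>) k) \<and>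
            \<bar>wave_factor t (?m \<delta>) k\<bar> \<le>
              max (t\<^sup>2 / 2) (2 / c) * (1 + (norm (freq k))\<^sup>2) powr (- min 1 ?r))"
        by eventually_elim (intro conjI allI dist coeff wave_factor_bound c; simp)
      show "((\<lambda>\<delta>. wave_factor t (?m \<delta>) k) \<longlongrightarrow> wave_factor t ?lap k) (at_right 0)" for k
        by (intro wave_factor_tendsto multiplier_tendsto assms(1)) (simp add: freq_eq_0_iff)
    qed simp
  qed
  moreover have "\<sigma> + 2 * min 1 ?r = s" if "\<beta> \<le> real CARD('n) + 2"
    using that unfolding s by (simp add: growth_def)
  moreover have "\<sigma> + 2 * min 1 ?r = s'" if "real CARD('n) + 2 < \<beta>"
    using that by (simp add: growth_def s'_def)
  ultimately show ?thesis by metis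
qed

end
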